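(* Let $(M,\circ,\nabla,e)$ be a flat F-manifold and let $g$ be an invariant (pseudo-)Riemannian metric on $M$ such that, with $\theta(X):=g(e,X)$, $$(\nabla_X g)(Y,Z)=\tfrac12 d\theta(X\circ Y,Z)+\tfrac12 d\theta(X\circ Z,Y)$$ for all vector fields $X,Y,Z$. Then $(M,\circ,g,e)$ is a (pseudo-)Riemannian F-manifold with Killing unit vector field.
   Context: $M$ is a smooth manifold; "vector field" means smooth local vector field; metrics are pseudo-Riemannian (nondegenerate, symmetric). $d\theta(X,Y)=X(\theta(Y))-Y(\theta(X))-\theta([X,Y])$. The Riemann tensor of a connection $\nabla$ is $R(X,Y)Z=\nabla_X\nabla_YZ-\nabla_Y\nabla_XZ-\nabla_{[X,Y]}Z$. F-manifold: a triple $(M,\circ,e)$ where $\circ$ is a commutative associative $C^\infty$-bilinear product on vector fields such that $\mathcal L_{X\circ Y}(\circ)=X\circ\mathcal L_Y(\circ)+Y\circ\mathcal L_X(\circ)$ for all vector fields $X,Y$ ($\circ$ being viewed as a $(1,2)$ tensor, $\mathcal L$ the Lie derivative), and $e$ is a vector field with $e\circ X=X$ for all $X$. A metric $g$ is invariant if $g(X\circ Y,Z)=g(X,Y\circ Z)$ for all vector fields $X,Y,Z$. (Pseudo-)Riemannian F-manifold with Killing unit vector field: an F-manifold $(M,\circ,e)$ with an invariant (pseudo-)Riemannian metric $g$ such that the Riemann tensor $R$ of (the Levi-Civita connection of) $g$ satisfies $R(Y,Z)(X\circ W)+R(X,Y)(Z\circ W)+R(Z,X)(Y\circ W)=0$ for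 all vector fields $X,Y,Z,W$, and $\mathcal L_e g=0$. Flat F-manifold: a tuple $(M,\circ,\nabla,e)$ where $\circ$ is a commutative associative $C^\infty$-bilinear product on vector fields with unit vector field $e$, and $\nabla$ is a torsionless flat connection with $\nabla e=0$ that is compatible with the product, i.e. writing $c(X,Y)=X\circ Y$, the expression $(\nabla_X c)(Y,Z)$ is symmetric in $X,Y,Z$. *)

theory Defs
  imports "HOL-Analysis.Analysis" "HOL-Library.Function_Algebras"
begin

section \<open>Smooth manifolds\<close>

text \<open>
  On an open set, \<open>C_k k\<close> says that all iterated directional derivatives up to order \<open>k\<close> exist and
  are continuous.
\<close>

primrec C_k :: "nat \<Rightarrow> ('e::real_normed_vector \<Rightarrow> 'b::real_normed_vector) \<Rightarrow> 'e set \<Rightarrow> bool" where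
  "C_k 0 f S \<longleftrightarrow> continuous_on S f"
| "C_k (Suc k) f S \<longleftrightarrow> (\<forall>x\<in>S. f differentiable (at x)) \<and>
     (\<forall>v. C_k k (\<lambda>x. frechet_derivative f (at x) v) S)"

definition C_infinity :: "('e::real_normed_vector \<Rightarrow> 'b::real_normed_vector) \<Rightarrow> 'e set \<Rightarrow> bool" where
  "C_infinity f S \<longleftrightarrow> (\<forall>k. C_k k f S)"

text \<open>A chart is its domain together with the coordinate map, whose values off the domain are irrelevant.\<close>

type_synonym ('a, 'e) chart = "'a set \<times> ('a \<Rightarrow> 'e)"

text \<open>The atlas need not be maximal; it determines the smooth structure.\<close>

definition smooth_manifold :: "'a topology \<Rightarrow> ('a, 'e::euclidean_space) chart set \<Rightarrow> bool" where
  "smooth_manifold M A \<longleftrightarrow>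
     Hausdorff_space M \<and> second_countable M \<and>
     (\<Union>(D, \<kappa>)\<in>A. D) = topspace M \<and>
     (\<forall>(D, \<kappa>)\<in>A. openin M D \<and> open (\<kappa> ` D) \<and>
        homeomorphic_map (subtopology M D) (top_of_set (\<kappa> ` D)) \<kappa>) \<and>
     (\<forall>(D, \<kappa>)\<in>A. \<forall>(D', \<kappa>')\<in>A. C_infinity (\<kappa>' \<circ> inv_into D \<kappa>) (\<kappa> ` (D \<inter> D')))"

definition smooth_fun :: "('a, 'e::euclidean_space) chart set \<Rightarrow> 'a set \<Rightarrow> ('a \<Rightarrow> real) \<Rightarrow> bool" where
  "smooth_fun A U f \<longleftrightarrow> (\<forall>(D, \<kappa>)\<in>A. C_infinity (f \<circ> inv_into D \<kappa>) (\<kappa> ` (D \<inter> U)))"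

definition smooth_near ::
  "'a topology \<Rightarrow> ('a, 'e::euclidean_space) chart set \<Rightarrow> 'a \<Rightarrow> ('a \<Rightarrow> real) \<Rightarrow> bool" where
  "smooth_near M A p f \<longleftrightarrow> (\<exists>U. openin M U \<and> p \<in> U \<and> smooth_fun A U f)"

section \<open>Tangent vectors and local vector fields\<close>

text \<open>
  Tangent vectors at \<open>p\<close> are the derivations of the algebra of germs at \<open>p\<close> of smooth functions. A germ
  is given by any total function that is smooth near \<open>p\<close>; the value \<open>0\<close> on all other functions makes
  equality of HOL functions the equality of tangent vectors, and makes the pointwise operations of
  \<^theory>\<open>HOL-Library.Function_Algebras\<close> the vector space operations.
\<close>

type_synonym 'a tangent = "('a \<Rightarrow> real) \<Rightarrow> real"

definition tangent_space ::
  "'a topology \<Rightarrow> ('a, 'e::euclidean_space) chart set \<Rightarrow> 'a \<Rightarrow> 'a tangent set" where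
  "tangent_space M A p = {v.
     (\<forall>f. \<not> smooth_near M A p f \<longrightarrow> v f = 0) \<and>
     (\<forall>f h. smooth_near M A p f \<and> smooth_near M A p h \<longrightarrow>
        v (f + h) = v f + v h \<and> v (f * h) = f p * v h + h p * v f) \<and>
     (\<forall>c f. smooth_near M A p f \<longrightarrow> v (\<lambda>q. c * f q) = c * v f) \<and>
     (\<forall>U f h. openin M U \<and> p \<in> U \<and> smooth_near M A p f \<and> (\<forall>q\<in>U. f q = h q) \<longrightarrow> v f = v h)}"

type_synonym 'a vfield = "'a \<Rightarrow> 'a tangent"

text \<open>
  \<open>vfields M A U\<close> are the smooth vector fields on the open set \<open>U\<close>. Their values off \<open>U\<close> are arbitrary,
  so restriction to a smaller open set is the identity, and two of them are the same vector field on
  \<open>U\<close> if \<open>eq_on_set U\<close> holds.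
\<close>

definition vfields ::
  "'a topology \<Rightarrow> ('a, 'e::euclidean_space) chart set \<Rightarrow> 'a set \<Rightarrow> 'a vfield set" where
  "vfields M A U = {X.
     (\<forall>p\<in>U. X p \<in> tangent_space M A p) \<and>
     (\<forall>V f. openin M V \<and> V \<subseteq> U \<and> smooth_fun A V f \<longrightarrow> smooth_fun A V (\<lambda>p. X p f))}"

definition eq_on_set :: "'a set \<Rightarrow> ('a \<Rightarrow> 'b) \<Rightarrow> ('a \<Rightarrow> 'b) \<Rightarrow> bool" where
  "eq_on_set U X Y \<longleftrightarrow> (\<forall>p\<in>U. X p = Y p)"

definition fun_scale :: "('a \<Rightarrow> real) \<Rightarrow> 'a vfield \<Rightarrow> 'a vfield" where
  "fun_scale h X = (\<lambda>p f. h p * X p f)"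

definition vapply :: "'a vfield \<Rightarrow> ('a \<Rightarrow> real) \<Rightarrow> 'a \<Rightarrow> real" where
  "vapply X h = (\<lambda>p. X p h)"

definition lie_bracket ::
  "'a topology \<Rightarrow> ('a, 'e::euclidean_space) chart set \<Rightarrow> 'a vfield \<Rightarrow> 'a vfield \<Rightarrow> 'a vfield" where
  "lie_bracket M A X Y = (\<lambda>p f.
     if smooth_near M A p f then X p (vapply Y f) - Y p (vapply X f) else 0)"

section \<open>Products and connections on local vector fields\<close>

text \<open>
  Operations on local vector fields are total functions on \<^typ>\<open>'a vfield\<close>. The second clause, required
  for every open \<open>U\<close>, says that the restriction of the result to \<open>U\<close> depends only on the restrictions of
  the arguments to \<open>U\<close>; so such an operation is a family of operations on the modules of vector fields
  on all open sets that is compatible with restriction.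
\<close>

definition local_biadditive ::
  "'a topology \<Rightarrow> ('a, 'e::euclidean_space) chart set \<Rightarrow> ('a vfield \<Rightarrow> 'a vfield \<Rightarrow> 'a vfield) \<Rightarrow> bool" where
  "local_biadditive M A B \<longleftrightarrow> (\<forall>U. openin M U \<longrightarrow>
     (\<forall>X\<in>vfields M A U. \<forall>Y\<in>vfields M A U. B X Y \<in> vfields M A U) \<and>
     (\<forall>X\<in>vfields M A U. \<forall>X'\<in>vfields M A U. \<forall>Y\<in>vfields M A U. \<forall>Y'\<in>vfields M A U.
        eq_on_set U X X' \<and> eq_on_set U Y Y' \<longrightarrow> eq_on_set U (B X Y) (B X' Y')) \<and>
     (\<forall>X\<in>vfields M A U. \<forall>Y\<in>vfields M A U. \<forall>Z\<in>vfields M A U.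
        eq_on_set U (B (X + Y) Z) (B X Z + B Y Z) \<and>
        eq_on_set U (B Z (X + Y)) (B Z X + B Z Y)))"

definition smooth_bilinear ::
  "'a topology \<Rightarrow> ('a, 'e::euclidean_space) chart set \<Rightarrow> ('a vfield \<Rightarrow> 'a vfield \<Rightarrow> 'a vfield) \<Rightarrow> bool" where
  "smooth_bilinear M A m \<longleftrightarrow> local_biadditive M A m \<and>
     (\<forall>U. openin M U \<longrightarrow>
       (\<forall>X\<in>vfields M A U. \<forall>Y\<in>vfields M A U. \<forall>h. smooth_fun A U h \<longrightarrow>
          eq_on_set U (m (fun_scale h X) Y) (fun_scale h (m X Y)) \<and>
          eq_on_set U (m X (fun_scale h Y)) (fun_scale h (m X Y))))"

definition unital_product ::
  "'a topology \<Rightarrow> ('a, 'e::euclidean_space) chart set \<Rightarrow> ('a vfield \<Rightarrow> 'a vfield \<Rightarrow> 'a vfield) \<Rightarrow>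
   'a vfield \<Rightarrow> bool" where
  "unital_product M A m e \<longleftrightarrow> smooth_bilinear M A m \<and> e \<in> vfields M A (topspace M) \<and>
     (\<forall>U. openin M U \<longrightarrow>
       (\<forall>X\<in>vfields M A U. \<forall>Y\<in>vfields M A U. \<forall>Z\<in>vfields M A U.
          eq_on_set U (m X Y) (m Y X) \<and>
          eq_on_set U (m (m X Y) Z) (m X (m Y Z)) \<and>
          eq_on_set U (m e X) X))"

definition connection ::
  "'a topology \<Rightarrow> ('a, 'e::euclidean_space) chart set \<Rightarrow> ('a vfield \<Rightarrow> 'a vfield \<Rightarrow> 'a vfield) \<Rightarrow> bool" where
  "connection M A D \<longleftrightarrow> local_biadditive M A D \<and>
     (\<forall>U. openin M U \<longrightarrow>
       (\<forall>X\<in>vfields M A U. \<forall>Y\<in>vfields M A U. \<forall>h. smooth_fun A U h \<longrightarrow>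
          eq_on_set U (D (fun_scale h X) Y) (fun_scale h (D X Y)) \<and>
          eq_on_set U (D X (fun_scale h Y)) (fun_scale h (D X Y) + fun_scale (vapply X h) Y)))"

definition torsionless ::
  "'a topology \<Rightarrow> ('a, 'e::euclidean_space) chart set \<Rightarrow> ('a vfield \<Rightarrow> 'a vfield \<Rightarrow> 'a vfield) \<Rightarrow> bool" where
  "torsionless M A D \<longleftrightarrow> (\<forall>U. openin M U \<longrightarrow>
     (\<forall>X\<in>vfields M A U. \<forall>Y\<in>vfields M A U.
        eq_on_set U (D X Y - D Y X) (lie_bracket M A X Y)))"

definition riemann ::
  "'a topology \<Rightarrow> ('a, 'e::euclidean_space) chart set \<Rightarrow> ('a vfield \<Rightarrow> 'a vfield \<Rightarrow> 'a vfield) \<Rightarrow>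
   'a vfield \<Rightarrow> 'a vfield \<Rightarrow> 'a vfield \<Rightarrow> 'a vfield" where
  "riemann M A D X Y Z = D X (D Y Z) - D Y (D X Z) - D (lie_bracket M A X Y) Z"

definition flat_connection ::
  "'a topology \<Rightarrow> ('a, 'e::euclidean_space) chart set \<Rightarrow> ('a vfield \<Rightarrow> 'a vfield \<Rightarrow> 'a vfield) \<Rightarrow> bool" where
  "flat_connection M A D \<longleftrightarrow> (\<forall>U. openin M U \<longrightarrow>
     (\<forall>X\<in>vfields M A U. \<forall>Y\<in>vfields M A U. \<forall>Z\<in>vfields M A U.
        eq_on_set U (riemann M A D X Y Z) 0))"

section \<open>F-manifolds and flat F-manifolds\<close>

text \<open>\<open>(\<L>\<^sub>X m)(Y, Z)\<close> for the \<open>(1,2)\<close> tensor \<open>m\<close>.\<close>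

definition lie_deriv_product ::
  "'a topology \<Rightarrow> ('a, 'e::euclidean_space) chart set \<Rightarrow> 'a vfield \<Rightarrow>
   ('a vfield \<Rightarrow> 'a vfield \<Rightarrow> 'a vfield) \<Rightarrow> 'a vfield \<Rightarrow> 'a vfield \<Rightarrow> 'a vfield" where
  "lie_deriv_product M A X m Y Z =
     lie_bracket M A X (m Y Z) - m (lie_bracket M A X Y) Z - m Y (lie_bracket M A X Z)"

definition F_manifold ::
  "'a topology \<Rightarrow> ('a, 'e::euclidean_space) chart set \<Rightarrow> ('a vfield \<Rightarrow> 'a vfield \<Rightarrow> 'a vfield) \<Rightarrow>
   'a vfield \<Rightarrow> bool" where
  "F_manifold M A m e \<longleftrightarrow> unital_product M A m e \<and>
     (\<forall>U. openin M U \<longrightarrow>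
       (\<forall>X\<in>vfields M A U. \<forall>Y\<in>vfields M A U. \<forall>Z\<in>vfields M A U. \<forall>W\<in>vfields M A U.
          eq_on_set U (lie_deriv_product M A (m X Y) m Z W)
            (m X (lie_deriv_product M A Y m Z W) + m Y (lie_deriv_product M A X m Z W))))"

text \<open>\<open>(\<nabla>\<^sub>X c)(Y, Z)\<close> for \<open>c = m\<close> and \<open>\<nabla> = D\<close>.\<close>

definition cov_deriv_product ::
  "('a vfield \<Rightarrow> 'a vfield \<Rightarrow> 'a vfield) \<Rightarrow> ('a vfield \<Rightarrow> 'a vfield \<Rightarrow> 'a vfield) \<Rightarrow>
   'a vfield \<Rightarrow> 'a vfield \<Rightarrow> 'a vfield \<Rightarrow> 'a vfield" where
  "cov_deriv_product D m X Y Z = D X (m Y Z) - m (D X Y) Z - m Y (D X Z)"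

definition flat_F_manifold ::
  "'a topology \<Rightarrow> ('a, 'e::euclidean_space) chart set \<Rightarrow> ('a vfield \<Rightarrow> 'a vfield \<Rightarrow> 'a vfield) \<Rightarrow>
   ('a vfield \<Rightarrow> 'a vfield \<Rightarrow> 'a vfield) \<Rightarrow> 'a vfield \<Rightarrow> bool" where
  "flat_F_manifold M A m D e \<longleftrightarrow> unital_product M A m e \<and>
     connection M A D \<and> torsionless M A D \<and> flat_connection M A D \<and>
     (\<forall>U. openin M U \<longrightarrow> (\<forall>X\<in>vfields M A U. eq_on_set U (D X e) 0)) \<and>
     (\<forall>U. openin M U \<longrightarrow>
       (\<forall>X\<in>vfields M A U. \<forall>Y\<in>vfields M A U. \<forall>Z\<in>vfields M A U.
          eq_on_set U (cov_deriv_product D m X Y Z) (cov_deriv_product D m Y X Z) \<and>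
          eq_on_set U (cov_deriv_product D m X Y Z) (cov_deriv_product D m X Z Y)))"

section \<open>Metrics\<close>

type_synonym 'a metric_field = "'a \<Rightarrow> 'a tangent \<Rightarrow> 'a tangent \<Rightarrow> real"

definition mapply :: "'a metric_field \<Rightarrow> 'a vfield \<Rightarrow> 'a vfield \<Rightarrow> 'a \<Rightarrow> real" where
  "mapply g X Y = (\<lambda>p. g p (X p) (Y p))"

definition pseudo_riemannian_metric ::
  "'a topology \<Rightarrow> ('a, 'e::euclidean_space) chart set \<Rightarrow> 'a metric_field \<Rightarrow> bool" where
  "pseudo_riemannian_metric M A g \<longleftrightarrow>
     (\<forall>p\<in>topspace M.
       (\<forall>u\<in>tangent_space M A p. \<forall>v\<in>tangent_space M A p. g p u v = g p v u) \<and>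
       (\<forall>u\<in>tangent_space M A p. \<forall>v\<in>tangent_space M A p. \<forall>w\<in>tangent_space M A p.
          g p (u + v) w = g p u w + g p v w) \<and>
       (\<forall>c. \<forall>u\<in>tangent_space M A p. \<forall>w\<in>tangent_space M A p.
          g p (\<lambda>f. c * u f) w = c * g p u w) \<and>
       (\<forall>u\<in>tangent_space M A p. (\<forall>w\<in>tangent_space M A p. g p u w = 0) \<longrightarrow> u = 0)) \<and>
     (\<forall>U. openin M U \<longrightarrow>
       (\<forall>X\<in>vfields M A U. \<forall>Y\<in>vfields M A U. smooth_fun A U (mapply g X Y)))"

definition invariant_metric ::
  "'a topology \<Rightarrow> ('a, 'e::euclidean_space) chart set \<Rightarrow> ('a vfield \<Rightarrow> 'a vfield \<Rightarrow> 'a vfield) \<Rightarrow>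
   'a metric_field \<Rightarrow> bool" where
  "invariant_metric M A m g \<longleftrightarrow> (\<forall>U. openin M U \<longrightarrow>
     (\<forall>X\<in>vfields M A U. \<forall>Y\<in>vfields M A U. \<forall>Z\<in>vfields M A U.
        eq_on_set U (mapply g (m X Y) Z) (mapply g X (m Y Z))))"

text \<open>\<open>(\<nabla>\<^sub>X g)(Y, Z)\<close> for \<open>\<nabla> = D\<close>.\<close>

definition cov_deriv_metric ::
  "('a vfield \<Rightarrow> 'a vfield \<Rightarrow> 'a vfield) \<Rightarrow> 'a metric_field \<Rightarrow>
   'a vfield \<Rightarrow> 'a vfield \<Rightarrow> 'a vfield \<Rightarrow> 'a \<Rightarrow> real" where
  "cov_deriv_metric D g X Y Z =
     vapply X (mapply g Y Z) - mapply g (D X Y) Z - mapply g Y (D X Z)"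

text \<open>\<open>(\<L>\<^sub>X g)(Y, Z)\<close>.\<close>

definition lie_deriv_metric ::
  "'a topology \<Rightarrow> ('a, 'e::euclidean_space) chart set \<Rightarrow> 'a vfield \<Rightarrow> 'a metric_field \<Rightarrow>
   'a vfield \<Rightarrow> 'a vfield \<Rightarrow> 'a \<Rightarrow> real" where
  "lie_deriv_metric M A X g Y Z =
     vapply X (mapply g Y Z) - mapply g (lie_bracket M A X Y) Z - mapply g Y (lie_bracket M A X Z)"

text \<open>The exterior derivative of a one-form, the latter given by its action on vector fields.\<close>

definition ext_deriv ::
  "'a topology \<Rightarrow> ('a, 'e::euclidean_space) chart set \<Rightarrow> ('a vfield \<Rightarrow> 'a \<Rightarrow> real) \<Rightarrow>
   'a vfield \<Rightarrow> 'a vfield \<Rightarrow> 'a \<Rightarrow> real" where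
  "ext_deriv M A \<theta> X Y = vapply X (\<theta> Y) - vapply Y (\<theta> X) - \<theta> (lie_bracket M A X Y)"

definition levi_civita ::
  "'a topology \<Rightarrow> ('a, 'e::euclidean_space) chart set \<Rightarrow> 'a metric_field \<Rightarrow>
   ('a vfield \<Rightarrow> 'a vfield \<Rightarrow> 'a vfield) \<Rightarrow> bool" where
  "levi_civita M A g D \<longleftrightarrow> connection M A D \<and> torsionless M A D \<and>
     (\<forall>U. openin M U \<longrightarrow>
       (\<forall>X\<in>vfields M A U. \<forall>Y\<in>vfields M A U. \<forall>Z\<in>vfields M A U.
          eq_on_set U (cov_deriv_metric D g X Y Z) 0))"

text \<open>
  The Levi-Civita connection is unique (up to values off the open sets on which its arguments are
  smooth vector fields), so the existential quantifier refers to the Levi-Civita connection of \<open>g\<close>.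
\<close>

definition riemannian_F_manifold_Killing_unit ::
  "'a topology \<Rightarrow> ('a, 'e::euclidean_space) chart set \<Rightarrow> ('a vfield \<Rightarrow> 'a vfield \<Rightarrow> 'a vfield) \<Rightarrow>
   'a metric_field \<Rightarrow> 'a vfield \<Rightarrow> bool" where
  "riemannian_F_manifold_Killing_unit M A m g e \<longleftrightarrow>
     F_manifold M A m e \<and> pseudo_riemannian_metric M A g \<and> invariant_metric M A m g \<and>
     (\<exists>D. levi_civita M A g D \<and>
       (\<forall>U. openin M U \<longrightarrow>
         (\<forall>X\<in>vfields M A U. \<forall>Y\<in>vfields M A U. \<forall>Z\<in>vfields M A U. \<forall>W\<in>vfields M A U.
            eq_on_set U
              (riemann M A D Y Z (m X W) + riemann M A D X Y (m Z W) + riemann M A D Z X (m Y W)) 0))) \<and>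
     (\<forall>U. openin M U \<longrightarrow>
       (\<forall>X\<in>vfields M A U. \<forall>Y\<in>vfields M A U. eq_on_set U (lie_deriv_metric M A e g X Y) 0))"

end

theory Submission
  imports Defs "Jordan_Normal_Form.Determinant"
begin

text \<open>
  Let \<open>\<Phi>\<close> be the endomorphism of the tangent bundle with \<open>g(\<Phi> X, Z) = d\<theta>(X, Z) / 2\<close>. The hypothesis on
  the metric then says \<open>(\<nabla>\<^sub>X g)(Y, Z) = g(\<Phi>(X \<circ> Y), Z) + g(Y, \<Phi>(X \<circ> Z))\<close>. Hence the connection
  \<open>\<nabla>'\<^sub>X Y = \<nabla>\<^sub>X Y + \<Phi>(X \<circ> Y)\<close> is metric, and it is torsionless because \<open>\<circ>\<close> is commutative: it is the
  Levi-Civita connection of \<open>g\<close> (\<open>levi_civita_corrected\<close>).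

  As \<open>\<nabla>\<close> is flat and \<open>\<nabla>c\<close> is symmetric, the curvature of \<open>\<nabla>'\<close> is
  \<open>R(X, Y)V = \<beta>(X, Y \<circ> V) - \<beta>(Y, X \<circ> V)\<close> with \<open>\<beta>(X, U) = \<nabla>\<^sub>X(\<Phi> U) - \<Phi>(\<nabla>\<^sub>X U) + \<Phi>(X \<circ> \<Phi> U)\<close>. In the cyclic sum
  of \<open>R(X, Y)(Z \<circ> W)\<close> these terms cancel in pairs by commutativity and associativity
  (\<open>cyclic_curvature\<close>). The identity for the Lie derivative of the product follows from the symmetry
  of \<open>\<nabla>c\<close> and two differentiated associative laws (\<open>Hertling_Manin\<close>). The unit is a Killing field since
  \<open>\<nabla>e = 0\<close> gives \<open>\<L>\<^sub>e g = \<nabla>\<^sub>e g\<close>, and \<open>(\<nabla>\<^sub>e g)(Y, Z) = (d\<theta>(Y, Z) + d\<theta>(Z, Y)) / 2 = 0\<close> (\<open>Killing_unit\<close>).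

  Analysis is needed for the existence and smoothness of \<open>\<Phi>\<close>, that is, for the isomorphism between
  one-forms and vector fields (\<open>sharp_vfields\<close>). Tangent vectors being derivations of germs, the Hadamard
  lemma has to show that the coordinate fields span each tangent space (\<open>tangent_expansion\<close>), so that
  the Gram matrix of the coordinate fields is invertible; Cramer's rule then gives smooth coefficients
  (\<open>smooth_linear_system\<close>). The two algebraic identities are proved in an abstract setting
  (\<open>flat_F_algebra\<close>) and transferred to the vector fields on each open set.
\<close>

(* The symbol denotes the inner product of a Euclidean space throughout. *)
no_notation scalar_prod (infix "\<bullet>" 70)

section \<open>Calculus of finitely differentiable functions on open sets\<close>

lemma C_k_cong:
  assumes "open S" "\<And>x. x \<in> S \<Longrightarrow> f x = h x"
  shows "C_k k f S \<longleftrightarrow> C_k k h S"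
  using assms(2)
proof (induction k arbitrary: f h)
  case 0
  then show ?case using continuous_on_cong[of S S f h] by simp
next
  case (Suc k)
  have der: "(f has_derivative F) (at x) \<longleftrightarrow> (h has_derivative F) (at x)" if "x \<in> S" for x F
    using has_derivative_transform_within_open[OF _ assms(1) that] Suc.prems by metis
  have "f differentiable (at x) \<longleftrightarrow> h differentiable (at x)" if "x \<in> S" for x
    using der[OF that] unfolding differentiable_def by auto
  moreover have "frechet_derivative f (at x) = frechet_derivative h (at x)" if "x \<in> S" for x
    using der[OF that] unfolding frechet_derivative_def by auto
  then have "C_k k (\<lambda>x. frechet_derivative f (at x) v) S \<longleftrightarrow> C_k k (\<lambda>x. frechet_derivative h (at x) v) S" for v
    by (intro Suc.IH) simp
  ultimately show ?case by simp
qed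

lemma C_k_congI: "open S \<Longrightarrow> C_k k f S \<Longrightarrow> (\<And>x. x \<in> S \<Longrightarrow> f x = h x) \<Longrightarrow> C_k k h S"
  using C_k_cong by blast

lemma C_k_subset: "C_k k f S \<Longrightarrow> T \<subseteq> S \<Longrightarrow> C_k k f T"
  by (induction k arbitrary: f) (auto intro: continuous_on_subset)

lemma C_k_imp_continuous_on: "C_k k f S \<Longrightarrow> continuous_on S f"
  by (cases k)
     (auto intro!: continuous_at_imp_continuous_on differentiable_imp_continuous_within)

lemma C_k_Suc_imp: "C_k (Suc k) f S \<Longrightarrow> C_k k f S"
proof (induction k arbitrary: f)
  case 0
  then show ?case
    by (auto intro!: continuous_at_imp_continuous_on differentiable_imp_continuous_within)
next
  case (Suc k)
  then show ?case by (metis C_k.simps(2))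
qed

lemma C_k_local:
  assumes "\<And>x. x \<in> S \<Longrightarrow> \<exists>T. open T \<and> x \<in> T \<and> C_k k f T"
  shows "C_k k f S"
  using assms
proof (induction k arbitrary: f)
  case 0
  then show ?case
    by (metis C_k.simps(1) continuous_at_imp_continuous_on continuous_on_eq_continuous_at)
next
  case (Suc k)
  have "f differentiable (at x)" if "x \<in> S" for x
    using Suc.prems[OF that] by auto
  moreover have "C_k k (\<lambda>x. frechet_derivative f (at x) v) S" for v
    using Suc.prems by (intro Suc.IH) fastforce
  ultimately show ?case by simp
qed

text \<open>
  \<open>C_k\<close> speaks of \<^const>\<open>frechet_derivative\<close>, which is awkward to compute with; in the inductions
  below it is enough to exhibit a derivative \<open>F\<close>, which is then the Frechet derivative by uniqueness.
\<close>

lemma C_k_SucI: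
  assumes "open S" "\<And>x. x \<in> S \<Longrightarrow> (f has_derivative F x) (at x)"
    and "\<And>v. C_k k (\<lambda>x. F x v) S"
  shows "C_k (Suc k) f S"
proof -
  have "frechet_derivative f (at x) = F x" if "x \<in> S" for x
    using frechet_derivative_at[OF assms(2)[OF that]] by simp
  then have "C_k k (\<lambda>x. frechet_derivative f (at x) v) S" for v
    using assms(3)[of v] C_k_cong[OF assms(1), of "\<lambda>x. frechet_derivative f (at x) v" "\<lambda>x. F x v" k]
    by simp
  moreover have "f differentiable (at x)" if "x \<in> S" for x
    using assms(2)[OF that] unfolding differentiable_def by blast
  ultimately show ?thesis by simp
qed

lemma C_k_SucD:
  assumes "C_k (Suc k) f S" "x \<in> S"
  shows "(f has_derivative frechet_derivative f (at x)) (at x)"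
  using assms by (simp add: frechet_derivative_works)

lemma C_k_const: "C_k k (\<lambda>x. c) S"
proof (induction k arbitrary: c)
  case (Suc k)
  have "frechet_derivative (\<lambda>x. c) (at x) = (\<lambda>_. 0)" for x :: 'a
    by simp
  then show ?case using Suc by simp
qed simp

lemma C_k_add:
  assumes "open S" "C_k k f S" "C_k k h S"
  shows "C_k k (\<lambda>x. f x + h x) S"
  using assms(2,3)
proof (induction k arbitrary: f h)
  case (Suc k)
  show ?case
  proof (rule C_k_SucI[OF assms(1)])
    fix x assume x: "x \<in> S"
    show "((\<lambda>x. f x + h x) has_derivative
        (\<lambda>v. frechet_derivative f (at x) v + frechet_derivative h (at x) v)) (at x)"
      using has_derivative_add[OF C_k_SucD[OF Suc.prems(1) x] C_k_SucD[OF Suc.prems(2) x]] .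
  qed (use Suc in auto)
qed (use continuous_on_add in auto)

text \<open>
  The product rule expresses the derivative of a product through products of functions that are
  \<open>k\<close> times differentiable, so one induction on \<open>k\<close> suffices. The inductions for inverses and
  compositions have the same form.
\<close>

lemma C_k_mult:
  fixes f h :: "_ \<Rightarrow> real"
  assumes "open S" "C_k k f S" "C_k k h S"
  shows "C_k k (\<lambda>x. f x * h x) S"
  using assms(2,3)
proof (induction k arbitrary: f h)
  case (Suc k)
  note * = Suc.prems C_k_Suc_imp[OF Suc.prems(1)] C_k_Suc_imp[OF Suc.prems(2)]
  show ?case
  proof (rule C_k_SucI[OF assms(1)])
    fix x assume x: "x \<in> S"
    show "((\<lambda>x. f x * h x) has_derivative
        (\<lambda>v. f x * frechet_derivative h (at x) v + frechet_derivative f (at x) v * h x)) (at x)"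
      using has_derivative_mult[OF C_k_SucD[OF Suc.prems(1) x] C_k_SucD[OF Suc.prems(2) x]] .
  next
    fix v
    show "C_k k (\<lambda>x. f x * frechet_derivative h (at x) v + frechet_derivative f (at x) v * h x) S"
      using * by (intro C_k_add[OF assms(1)] Suc.IH) auto
  qed
qed (use continuous_on_mult in auto)

lemma C_k_sum:
  assumes "open S" "\<And>i. i \<in> I \<Longrightarrow> C_k k (f i) S"
  shows "C_k k (\<lambda>x. \<Sum>i\<in>I. f i x) S"
  using assms(2)
proof (induction I rule: infinite_finite_induct)
  case (insert i I)
  then show ?case using C_k_add[OF assms(1), of k "f i" "\<lambda>x. \<Sum>i\<in>I. f i x"] by simp
qed (simp_all add: C_k_const)

lemma C_k_prod:
  fixes f :: "_ \<Rightarrow> _ \<Rightarrow> real"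
  assumes "open S" "\<And>i. i \<in> I \<Longrightarrow> C_k k (f i) S"
  shows "C_k k (\<lambda>x. \<Prod>i\<in>I. f i x) S"
  using assms(2)
proof (induction I rule: infinite_finite_induct)
  case (insert i I)
  then show ?case using C_k_mult[OF assms(1), of k "f i" "\<lambda>x. \<Prod>i\<in>I. f i x"] by simp
qed (simp_all add: C_k_const)

lemma C_k_inverse:
  fixes f :: "_ \<Rightarrow> real"
  assumes "open S" "C_k k f S" "\<And>x. x \<in> S \<Longrightarrow> f x \<noteq> 0"
  shows "C_k k (\<lambda>x. inverse (f x)) S"
  using assms(2)
proof (induction k)
  case (Suc k)
  show ?case
  proof (rule C_k_SucI[OF assms(1)])
    fix x assume x: "x \<in> S"
    show "((\<lambda>x. inverse (f x)) has_derivative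
        (\<lambda>v. (-1) * (inverse (f x) * frechet_derivative f (at x) v * inverse (f x)))) (at x)"
      using Deriv.has_derivative_inverse[OF assms(3)[OF x] C_k_SucD[OF Suc.prems x]] by simp
  next
    fix v
    have "C_k k (\<lambda>x. inverse (f x)) S"
      using Suc.IH C_k_Suc_imp[OF Suc.prems] by blast
    then show "C_k k (\<lambda>x. (-1) * (inverse (f x) * frechet_derivative f (at x) v * inverse (f x))) S"
      using Suc.prems by (intro C_k_mult[OF assms(1)] C_k_const) auto
  qed
qed (use assms in \<open>simp add: continuous_on_inverse\<close>)

lemma C_k_inner:
  assumes "open S" "C_k k f S"
  shows "C_k k (\<lambda>x. f x \<bullet> b) S"
  using assms(2)
proof (induction k arbitrary: f)
  case (Suc k)
  show ?case
  proof (rule C_k_SucI[OF assms(1)])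
    fix x assume x: "x \<in> S"
    show "((\<lambda>x. f x \<bullet> b) has_derivative (\<lambda>v. frechet_derivative f (at x) v \<bullet> b)) (at x)"
      using has_derivative_inner_left[OF C_k_SucD[OF Suc.prems x]] .
  qed (use Suc in auto)
qed (use continuous_on_inner[OF _ continuous_on_const] in auto)

lemma C_k_id: "C_k k (\<lambda>x. x) (S :: 'e::real_normed_vector set)"
proof (cases k)
  case (Suc j)
  have "frechet_derivative (\<lambda>x. x) (at x) = (\<lambda>v. v)" for x :: 'e
    by (metis frechet_derivative_at has_derivative_ident)
  then show ?thesis using Suc by (simp add: C_k_const)
qed simp

text \<open>
  Only derivatives in a fixed direction are known to be smooth; a derivative in a direction that
  varies with the point, as in the chain rule, has to be expanded in the directions of the basis.
\<close>

lemma frechet_derivative_basis: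
  fixes f :: "'e::euclidean_space \<Rightarrow> 'b::real_normed_vector"
  assumes "f differentiable (at x)"
  shows "frechet_derivative f (at x) v = (\<Sum>b\<in>Basis. (v \<bullet> b) *\<^sub>R frechet_derivative f (at x) b)"
proof -
  interpret linear "frechet_derivative f (at x)"
    using assms by (rule linear_frechet_derivative)
  show ?thesis by (subst euclidean_representation[of v, symmetric]) (simp only: sum scale)
qed

lemma C_k_compose:
  fixes f :: "'e::euclidean_space \<Rightarrow> real" and h :: "'d::real_normed_vector \<Rightarrow> 'e"
  assumes "open S" "C_k k f T" "C_k k h S" "h ` S \<subseteq> T"
  shows "C_k k (\<lambda>x. f (h x)) S"
  using assms(2,3)
proof (induction k arbitrary: f)
  case 0
  then show ?case using assms(4) by (auto intro: continuous_on_compose2)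
next
  case (Suc k)
  let ?f' = "\<lambda>b y. frechet_derivative f (at y) b"
  let ?h' = "\<lambda>x v. frechet_derivative h (at x) v"
  show ?case
  proof (rule C_k_SucI[OF assms(1)])
    fix x assume x: "x \<in> S"
    then have "h x \<in> T" using assms(4) by blast
    then have "f differentiable (at (h x))" using Suc.prems(1) by simp
    note * = frechet_derivative_basis[OF this]
    have "((\<lambda>x. f (h x)) has_derivative (\<lambda>v. frechet_derivative f (at (h x)) (?h' x v))) (at x)"
      using diff_chain_at[OF C_k_SucD[OF Suc.prems(2) x] C_k_SucD[OF Suc.prems(1) \<open>h x \<in> T\<close>]]
      by (simp add: o_def)
    then show "((\<lambda>x. f (h x)) has_derivative (\<lambda>v. \<Sum>b\<in>Basis. (?h' x v \<bullet> b) * ?f' b (h x))) (at x)"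
      by (subst (asm) *) simp
  next
    fix v
    have "C_k k (\<lambda>x. ?f' b (h x)) S" for b
      using Suc.prems C_k_Suc_imp by (intro Suc.IH) auto
    then show "C_k k (\<lambda>x. \<Sum>b\<in>Basis. (?h' x v \<bullet> b) * ?f' b (h x)) S"
      using Suc.prems by (intro C_k_sum C_k_mult C_k_inner assms(1)) auto
  qed
qed

section \<open>The Hadamard lemma\<close>

lemma radial_in_ball:
  fixes a :: "'e::real_normed_vector"
  assumes "x \<in> ball a r" "0 \<le> t" "t \<le> 1"
  shows "a + t *\<^sub>R (x - a) \<in> ball a r"
proof -
  have "t * norm (x - a) \<le> 1 * norm (x - a)"
    using assms by (intro mult_right_mono) auto
  then show ?thesis using assms by (simp add: dist_norm norm_minus_commute)
qed

lemma continuous_on_radial: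
  fixes f :: "'e::real_normed_vector \<Rightarrow> real"
  assumes "continuous_on (ball a r) f"
  shows "continuous_on (ball a r \<times> {0..1}) (\<lambda>z. snd z ^ j * f (a + snd z *\<^sub>R (fst z - a)))"
  by (rule continuous_on_mult[OF _ continuous_on_compose2[OF assms]])
     (auto intro!: continuous_intros radial_in_ball simp del: mem_ball)

lemma continuous_on_slice:
  assumes "continuous_on (S \<times> T) F" "x \<in> S"
  shows "continuous_on T (\<lambda>t. F (x, t))"
  using assms by (intro continuous_on_compose2[OF assms(1)]) (auto intro!: continuous_intros)

text \<open>
  The weight \<open>t ^ j\<close> makes the statement inductive: differentiating \<open>f (a + t *\<^sub>R (x - a))\<close> with respect
  to \<open>x\<close> produces a factor \<open>t\<close>, so the derivative of the integral is an integral of the same kind with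
  \<open>j\<close> increased and \<open>f\<close> replaced by a directional derivative.
\<close>

lemma C_k_radial_integral:
  fixes f :: "'e::euclidean_space \<Rightarrow> real"
  assumes "C_k k f (ball a r)"
  shows "C_k k (\<lambda>x. integral {0..1} (\<lambda>t. t ^ j * f (a + t *\<^sub>R (x - a)))) (ball a r)"
  using assms
proof (induction k arbitrary: f j)
  case 0
  have "continuous_on (ball a r \<times> cbox 0 (1::real)) (\<lambda>(x, t). t ^ j * f (a + t *\<^sub>R (x - a)))"
    using continuous_on_radial[of a r f j] 0 by (simp add: split_beta)
  from integral_continuous_on_param[OF this] show ?case by simp
next
  case (Suc k)
  define f' where "f' b = (\<lambda>y. frechet_derivative f (at y) b)" for b
  have f': "C_k k (f' b) (ball a r)" for b
    using Suc.prems by (simp add: f'_def)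
  then have cf': "continuous_on (ball a r) (f' b)" for b
    by (rule C_k_imp_continuous_on)
  \<comment> \<open>The derivative of the integrand as a bounded linear map, in the form that makes its joint continuity evident.\<close>
  define H where "H x t = (\<Sum>b\<in>Basis. (t ^ Suc j * f' b (a + t *\<^sub>R (x - a))) *\<^sub>R blinfun_inner_left b)"
    for x :: 'e and t :: real
  have H_apply: "blinfun_apply (H x t) v = t ^ Suc j * f' v (a + t *\<^sub>R (x - a))"
    if "x \<in> ball a r" "t \<in> {0..1}" for x t v
  proof -
    have "f differentiable (at (a + t *\<^sub>R (x - a)))"
      using Suc.prems radial_in_ball[OF that(1), of t] that(2) by simp
    from frechet_derivative_basis[OF this, of v] show ?thesis
      by (simp add: H_def f'_def blinfun.sum_left blinfun.scaleR_left sum_distrib_left mult_ac)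
  qed
  have cH: "continuous_on (ball a r \<times> {0..1}) (\<lambda>z. H (fst z) (snd z))"
    unfolding H_def
    by (intro continuous_on_sum continuous_on_scaleR continuous_on_const continuous_on_radial cf')
  have int_H: "H x integrable_on {0..1}" if "x \<in> ball a r" for x
    using continuous_on_slice[OF cH that] by (intro integrable_continuous_interval) simp
  show ?case
  proof (rule C_k_SucI[OF open_ball])
    fix x assume x: "x \<in> ball a r"
    have "((\<lambda>x. integral (cbox 0 1) (\<lambda>t. t ^ j * f (a + t *\<^sub>R (x - a)))) has_derivative
            integral (cbox 0 1) (H x)) (at x within ball a r)"
    proof (rule leibniz_rule[where fx = H])
      fix y and t :: real assume y: "y \<in> ball a r" and t: "t \<in> cbox 0 1"
      have "a + t *\<^sub>R (y - a) \<in> ball a r" using radial_in_ball[OF y, of t] t by simp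
      from C_k_SucD[OF Suc.prems this]
      have "(f has_derivative (\<lambda>v. f' v (a + t *\<^sub>R (y - a)))) (at (a + t *\<^sub>R (y - a)))"
        by (simp add: f'_def)
      moreover have "((\<lambda>y. a + t *\<^sub>R (y - a)) has_derivative (\<lambda>v. t *\<^sub>R v)) (at y)"
        by (auto intro!: derivative_eq_intros)
      ultimately have "((\<lambda>y. f (a + t *\<^sub>R (y - a))) has_derivative
          (\<lambda>v. f' (t *\<^sub>R v) (a + t *\<^sub>R (y - a)))) (at y)"
        using diff_chain_at by (fastforce simp: o_def)
      then have "((\<lambda>y. t ^ j * f (a + t *\<^sub>R (y - a))) has_derivative
          (\<lambda>v. t ^ j * f' (t *\<^sub>R v) (a + t *\<^sub>R (y - a)))) (at y)"
        by (rule has_derivative_mult_right)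
      moreover
      have "f' (t *\<^sub>R v) (a + t *\<^sub>R (y - a)) = t * f' v (a + t *\<^sub>R (y - a))" for v :: 'e
      proof -
        have "f differentiable (at (a + t *\<^sub>R (y - a)))"
          using Suc.prems \<open>a + t *\<^sub>R (y - a) \<in> ball a r\<close> by simp
        from linear_cmul[OF linear_frechet_derivative[OF this]] show ?thesis by (simp add: f'_def)
      qed
      then have "(\<lambda>v. t ^ j * f' (t *\<^sub>R v) (a + t *\<^sub>R (y - a))) = blinfun_apply (H y t)"
        using H_apply[OF y, of t] t by (auto simp: mult_ac)
      ultimately have "((\<lambda>y. t ^ j * f (a + t *\<^sub>R (y - a))) has_derivative
          blinfun_apply (H y t)) (at y)"
        by (simp only:)
      then show "((\<lambda>y. t ^ j * f (a + t *\<^sub>R (y - a))) has_derivative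
          blinfun_apply (H y t)) (at y within ball a r)"
        by (rule has_derivative_at_withinI)
    next
      fix y assume y: "y \<in> ball a r"
      have "continuous_on (ball a r) f"
        using Suc.prems by (rule C_k_imp_continuous_on)
      from continuous_on_slice[OF continuous_on_radial[OF this, of j] y]
      show "(\<lambda>t. t ^ j * f (a + t *\<^sub>R (y - a))) integrable_on cbox 0 1"
        by (intro integrable_continuous) simp
    qed (use cH x in \<open>auto simp: split_beta convex_ball\<close>)
    then have "((\<lambda>x. integral {0..1} (\<lambda>t. t ^ j * f (a + t *\<^sub>R (x - a)))) has_derivative
            integral {0..1} (H x)) (at x)"
      using at_within_open[OF x open_ball] by simp
    moreover have "blinfun_apply (integral {0..1} (H x)) =
        (\<lambda>v. integral {0..1} (\<lambda>t. t ^ Suc j * f' v (a + t *\<^sub>R (x - a))))"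
    proof
      fix v
      have "blinfun_apply (integral {0..1} (H x)) v = integral {0..1} (\<lambda>t. blinfun_apply (H x t) v)"
        using integral_linear[OF int_H[OF x], of "\<lambda>F. blinfun_apply F v"]
        by (simp add: o_def bounded_linear_blinfun_apply blinfun.bounded_linear_left)
      also have "\<dots> = integral {0..1} (\<lambda>t. t ^ Suc j * f' v (a + t *\<^sub>R (x - a)))"
        by (rule integral_cong) (use H_apply[OF x] in simp)
      finally show "blinfun_apply (integral {0..1} (H x)) v =
        integral {0..1} (\<lambda>t. t ^ Suc j * f' v (a + t *\<^sub>R (x - a)))" .
    qed
    ultimately show "((\<lambda>x. integral {0..1} (\<lambda>t. t ^ j * f (a + t *\<^sub>R (x - a)))) has_derivative
        (\<lambda>v. integral {0..1} (\<lambda>t. t ^ Suc j * f' v (a + t *\<^sub>R (x - a))))) (at x)"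
      by (simp only:)
  next
    fix v
    show "C_k k (\<lambda>x. integral {0..1} (\<lambda>t. t ^ Suc j * f' v (a + t *\<^sub>R (x - a)))) (ball a r)"
      by (rule Suc.IH[OF f'])
  qed
qed

text \<open>
  By the fundamental theorem of calculus along the segment from \<open>a\<close> to \<open>x\<close>, the coefficient of
  \<open>(x - a) \<bullet> b\<close> can be taken to be the integral of the derivative in direction \<open>b\<close> along that segment.
  It is smooth by differentiation under the integral sign.
\<close>

lemma Hadamard:
  fixes f :: "'e::euclidean_space \<Rightarrow> real"
  assumes f: "C_infinity f (ball a r)"
  obtains h where "\<And>b. C_infinity (h b) (ball a r)"
    and "\<And>x. x \<in> ball a r \<Longrightarrow> f x = f a + (\<Sum>b\<in>Basis. ((x - a) \<bullet> b) * h b x)"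
    and "\<And>b. h b a = frechet_derivative f (at a) b"
proof
  let ?h = "\<lambda>b x. integral {0..1} (\<lambda>t. t ^ 0 * frechet_derivative f (at (a + t *\<^sub>R (x - a))) b)"
  have sm: "C_k k (\<lambda>x. frechet_derivative f (at x) b) (ball a r)" for k b
    using f unfolding C_infinity_def by (metis C_k.simps(2))
  have diff: "f differentiable (at x)" if "x \<in> ball a r" for x
    using f that unfolding C_infinity_def by (metis C_k.simps(2))
  show "C_infinity (?h b) (ball a r)" for b
    unfolding C_infinity_def
    using C_k_radial_integral[OF sm] by blast
  show "?h b a = frechet_derivative f (at a) b" for b
    by simp
  fix x assume x: "x \<in> ball a r"
  let ?c = "\<lambda>t. a + t *\<^sub>R (x - a)"
  have cf': "continuous_on (ball a r) (\<lambda>x. frechet_derivative f (at x) b)" for b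
    using sm[of 0] by simp
  have int: "(\<lambda>t. frechet_derivative f (at (?c t)) b) integrable_on {0..1}" for b
    using continuous_on_slice[OF continuous_on_radial[OF cf', of 0 b] x]
    by (intro integrable_continuous_interval) simp
  have "((\<lambda>t. f (?c t)) has_vector_derivative frechet_derivative f (at (?c t)) (x - a)) (at t within {0..1})"
    if "t \<in> {0..1}" for t
  proof -
    have c: "?c t \<in> ball a r" using radial_in_ball[OF x] that by simp
    have "(f has_derivative frechet_derivative f (at (?c t))) (at (?c t))"
      using diff[OF c] by (simp add: frechet_derivative_works)
    moreover have "(?c has_derivative (\<lambda>s. s *\<^sub>R (x - a))) (at t)"
      by (auto intro!: derivative_eq_intros)
    ultimately have "((\<lambda>t. f (?c t)) has_derivative
        (\<lambda>s. frechet_derivative f (at (?c t)) (s *\<^sub>R (x - a)))) (at t)"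
      using diff_chain_at[of ?c] by (fastforce simp: o_def)
    then show ?thesis
      using linear_cmul[OF linear_frechet_derivative[OF diff[OF c]]]
      by (simp add: has_vector_derivative_def has_derivative_at_withinI)
  qed
  then have "((\<lambda>t. frechet_derivative f (at (?c t)) (x - a)) has_integral (f (?c 1) - f (?c 0))) {0..1}"
    by (intro fundamental_theorem_of_calculus) auto
  then have "f x - f a = integral {0..1} (\<lambda>t. frechet_derivative f (at (?c t)) (x - a))"
    by (simp add: integral_unique)
  also have "\<dots> = integral {0..1} (\<lambda>t. \<Sum>b\<in>Basis. ((x - a) \<bullet> b) * frechet_derivative f (at (?c t)) b)"
  proof (rule integral_cong)
    fix t :: real assume "t \<in> {0..1}"
    then have "f differentiable (at (?c t))" using diff radial_in_ball[OF x] by simp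
    from frechet_derivative_basis[OF this, of "x - a"]
    show "frechet_derivative f (at (?c t)) (x - a) =
        (\<Sum>b\<in>Basis. ((x - a) \<bullet> b) * frechet_derivative f (at (?c t)) b)" by simp
  qed
  also have "\<dots> = (\<Sum>b\<in>Basis. integral {0..1} (\<lambda>t. ((x - a) \<bullet> b) * frechet_derivative f (at (?c t)) b))"
    using int by (intro integral_sum integrable_on_mult_right) auto
  finally show "f x = f a + (\<Sum>b\<in>Basis. ((x - a) \<bullet> b) * ?h b x)" by simp
qed

section \<open>Smooth functions on a manifold\<close>

lemma sum_fun_apply: "(\<Sum>i\<in>I. f i) q = (\<Sum>i\<in>I. f i q)"
  by (induction I rule: infinite_finite_induct) auto

lemma eq_on_setD: "eq_on_set U X Y \<Longrightarrow> p \<in> U \<Longrightarrow> X p = Y p"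
  by (simp add: eq_on_set_def)

lemma eq_on_setI: "(\<And>p. p \<in> U \<Longrightarrow> X p = Y p) \<Longrightarrow> eq_on_set U X Y"
  by (simp add: eq_on_set_def)

locale smooth_atlas =
  fixes M :: "'a topology" and A :: "('a, 'e::euclidean_space) chart set"
  assumes manifold: "smooth_manifold M A"
begin

lemma chart_openin: "(D, \<kappa>) \<in> A \<Longrightarrow> openin M D"
  and chart_homeomorphic:
    "(D, \<kappa>) \<in> A \<Longrightarrow> homeomorphic_map (subtopology M D) (top_of_set (\<kappa> ` D)) \<kappa>"
  and chart_open_image: "(D, \<kappa>) \<in> A \<Longrightarrow> open (\<kappa> ` D)"
  using manifold unfolding smooth_manifold_def by blast+

lemma transition_smooth:
  "(D, \<kappa>) \<in> A \<Longrightarrow> (D', \<kappa>') \<in> A \<Longrightarrow> C_infinity (\<kappa>' \<circ> inv_into D \<kappa>) (\<kappa> ` (D \<inter> D'))"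
  using manifold unfolding smooth_manifold_def by blast

lemma chart_around:
  assumes "p \<in> topspace M"
  obtains D \<kappa> where "(D, \<kappa>) \<in> A" "p \<in> D"
  using assms manifold unfolding smooth_manifold_def by blast

lemma chart_topspace: "(D, \<kappa>) \<in> A \<Longrightarrow> topspace (subtopology M D) = D"
  using openin_subset[OF chart_openin] by auto

lemma chart_inj: "(D, \<kappa>) \<in> A \<Longrightarrow> inj_on \<kappa> D"
  using homeomorphic_imp_injective_map[OF chart_homeomorphic] chart_topspace by metis

lemma chart_inv: "(D, \<kappa>) \<in> A \<Longrightarrow> q \<in> D \<Longrightarrow> inv_into D \<kappa> (\<kappa> q) = q"
  using chart_inj by (simp add: inv_into_f_f)

text \<open>
  The calculus above concerns open subsets of a Euclidean space; this fact makes it applicable to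
  coordinate expressions on arbitrary open subsets of a chart domain.
\<close>

lemma open_chart_image:
  assumes "(D, \<kappa>) \<in> A" "openin M U"
  shows "open (\<kappa> ` (D \<inter> U))"
proof -
  have "openin (subtopology M D) (D \<inter> U)"
    using assms(2) by (auto simp: openin_subtopology)
  then have "openin (top_of_set (\<kappa> ` D)) (\<kappa> ` (D \<inter> U))"
    using homeomorphic_imp_open_map[OF chart_homeomorphic[OF assms(1)]]
    by (simp add: open_map_def)
  then show ?thesis
    using openin_open_eq[OF chart_open_image[OF assms(1)]] by blast
qed

lemma openin_chart_preimage:
  assumes "(D, \<kappa>) \<in> A" "open W"
  shows "openin M {q \<in> D. \<kappa> q \<in> W}"
proof -
  have "continuous_map (subtopology M D) (top_of_set (\<kappa> ` D)) \<kappa>"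
    using homeomorphic_imp_continuous_map[OF chart_homeomorphic[OF assms(1)]] .
  moreover have "openin (top_of_set (\<kappa> ` D)) (\<kappa> ` D \<inter> W)"
    using assms(2) by (auto simp: openin_open)
  ultimately have "openin (subtopology M D) {q \<in> D. \<kappa> q \<in> \<kappa> ` D \<inter> W}"
    using openin_continuous_map_preimage[of "subtopology M D" _ \<kappa>] chart_topspace[OF assms(1)]
    by fastforce
  then have "openin M {q \<in> D. \<kappa> q \<in> \<kappa> ` D \<inter> W}"
    by (rule openin_trans_full[OF _ chart_openin[OF assms(1)]])
  moreover have "{q \<in> D. \<kappa> q \<in> \<kappa> ` D \<inter> W} = {q \<in> D. \<kappa> q \<in> W}" by auto
  ultimately show ?thesis by simp
qed

lemma smooth_fun_iff:
  "smooth_fun A U f \<longleftrightarrow> (\<forall>D \<kappa>. (D, \<kappa>) \<in> A \<longrightarrow> (\<forall>k. C_k k (\<lambda>x. f (inv_into D \<kappa> x)) (\<kappa> ` (D \<inter> U))))"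
  unfolding smooth_fun_def C_infinity_def o_def by auto

lemma smooth_funD: "smooth_fun A U f \<Longrightarrow> (D, \<kappa>) \<in> A \<Longrightarrow> C_k k (\<lambda>x. f (inv_into D \<kappa> x)) (\<kappa> ` (D \<inter> U))"
  unfolding smooth_fun_iff by blast

lemma smooth_fun_subset: "smooth_fun A U f \<Longrightarrow> V \<subseteq> U \<Longrightarrow> smooth_fun A V f"
  unfolding smooth_fun_iff by (metis C_k_subset Int_mono image_mono order_refl)

lemma smooth_fun_cong:
  assumes "openin M U" "\<And>p. p \<in> U \<Longrightarrow> f p = h p"
  shows "smooth_fun A U f \<longleftrightarrow> smooth_fun A U h"
proof -
  have "C_k k (\<lambda>x. f (inv_into D \<kappa> x)) (\<kappa> ` (D \<inter> U)) \<longleftrightarrow> C_k k (\<lambda>x. h (inv_into D \<kappa> x)) (\<kappa> ` (D \<inter> U))"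
    if "(D, \<kappa>) \<in> A" for D \<kappa> k
    using assms(2) chart_inv[OF that] by (intro C_k_cong open_chart_image that assms(1)) auto
  then show ?thesis unfolding smooth_fun_iff by blast
qed

lemma smooth_fun_local:
  assumes "\<And>p. p \<in> U \<Longrightarrow> \<exists>V. openin M V \<and> p \<in> V \<and> smooth_fun A V f"
  shows "smooth_fun A U f"
  unfolding smooth_fun_iff
proof (intro allI impI C_k_local)
  fix D \<kappa> k x assume c: "(D, \<kappa>) \<in> A" and "x \<in> \<kappa> ` (D \<inter> U)"
  then obtain p where p: "p \<in> D" "p \<in> U" "x = \<kappa> p" by auto
  then obtain V where V: "openin M V" "p \<in> V" "smooth_fun A V f" using assms by blast
  then show "\<exists>T. open T \<and> x \<in> T \<and> C_k k (\<lambda>x. f (inv_into D \<kappa> x)) T"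
    using p open_chart_image[OF c V(1)] smooth_funD[OF V(3) c]
    by (intro exI[of _ "\<kappa> ` (D \<inter> V)"]) auto
qed

lemma smooth_fun_const: "smooth_fun A U (\<lambda>q. c)"
  unfolding smooth_fun_iff by (simp add: C_k_const)

lemma smooth_fun_add:
  "openin M U \<Longrightarrow> smooth_fun A U f \<Longrightarrow> smooth_fun A U h \<Longrightarrow> smooth_fun A U (\<lambda>q. f q + h q)"
  unfolding smooth_fun_iff by (simp add: C_k_add open_chart_image)

lemma smooth_fun_mult:
  "openin M U \<Longrightarrow> smooth_fun A U f \<Longrightarrow> smooth_fun A U h \<Longrightarrow> smooth_fun A U (\<lambda>q. f q * h q)"
  unfolding smooth_fun_iff by (simp add: C_k_mult open_chart_image)

lemma smooth_fun_sum:
  "openin M U \<Longrightarrow> (\<And>i. i \<in> I \<Longrightarrow> smooth_fun A U (f i)) \<Longrightarrow> smooth_fun A U (\<lambda>q. \<Sum>i\<in>I. f i q)"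
  unfolding smooth_fun_iff by (simp add: C_k_sum open_chart_image)

lemma smooth_fun_prod:
  "openin M U \<Longrightarrow> (\<And>i. i \<in> I \<Longrightarrow> smooth_fun A U (f i)) \<Longrightarrow> smooth_fun A U (\<lambda>q. \<Prod>i\<in>I. f i q)"
  unfolding smooth_fun_iff by (simp add: C_k_prod open_chart_image)

lemma smooth_fun_inverse:
  assumes "openin M U" "smooth_fun A U f" "\<And>p. p \<in> U \<Longrightarrow> f p \<noteq> 0"
  shows "smooth_fun A U (\<lambda>q. inverse (f q))"
  unfolding smooth_fun_iff
proof (intro allI impI C_k_inverse)
  fix D \<kappa> x assume "(D, \<kappa>) \<in> A" "x \<in> \<kappa> ` (D \<inter> U)"
  then show "f (inv_into D \<kappa> x) \<noteq> 0" using chart_inv assms(3) by auto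
qed (use assms open_chart_image smooth_funD in auto)

text \<open>
  Smoothness may be tested in a single chart, because the coordinate expressions in the other charts
  arise by composition with the smooth transition maps.
\<close>

lemma smooth_fun_chartI:
  assumes c: "(D, \<kappa>) \<in> A" and U: "openin M U" "U \<subseteq> D"
    and f: "\<And>k. C_k k (\<lambda>x. f (inv_into D \<kappa> x)) (\<kappa> ` U)"
  shows "smooth_fun A U f"
  unfolding smooth_fun_iff
proof (intro allI impI)
  fix D' \<kappa>' k assume c': "(D', \<kappa>') \<in> A"
  let ?S = "\<kappa>' ` (D' \<inter> U)"
  have S: "open ?S" by (rule open_chart_image[OF c' U(1)])
  have \<tau>: "C_k k (\<kappa> \<circ> inv_into D' \<kappa>') ?S"
  proof (rule C_k_subset)
    show "C_k k (\<kappa> \<circ> inv_into D' \<kappa>') (\<kappa>' ` (D' \<inter> D))"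
      using transition_smooth[OF c' c] unfolding C_infinity_def by blast
  qed (use U(2) in blast)
  have "(\<kappa> \<circ> inv_into D' \<kappa>') ` ?S \<subseteq> \<kappa> ` U"
    using chart_inv[OF c'] by auto
  from C_k_compose[OF S f \<tau> this]
  have "C_k k (\<lambda>x. f (inv_into D \<kappa> ((\<kappa> \<circ> inv_into D' \<kappa>') x))) ?S" .
  moreover have "f (inv_into D \<kappa> ((\<kappa> \<circ> inv_into D' \<kappa>') x)) = f (inv_into D' \<kappa>' x)" if "x \<in> ?S" for x
    using that chart_inv[OF c'] chart_inv[OF c] U(2) by auto
  ultimately show "C_k k (\<lambda>x. f (inv_into D' \<kappa>' x)) ?S"
    by (rule C_k_congI[OF S])
qed

lemma smooth_fun_coordinate:
  assumes c: "(D, \<kappa>) \<in> A"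
  shows "smooth_fun A D (\<lambda>q. \<kappa> q \<bullet> b)"
proof (rule smooth_fun_chartI[OF c chart_openin[OF c] order_refl])
  fix k
  have "C_k k (\<lambda>x. x \<bullet> b) (\<kappa> ` D)"
    by (intro C_k_inner C_k_id chart_open_image[OF c])
  then show "C_k k (\<lambda>x. \<kappa> (inv_into D \<kappa> x) \<bullet> b) (\<kappa> ` D)"
    using C_k_cong[OF chart_open_image[OF c], of "\<lambda>x. x \<bullet> b" "\<lambda>x. \<kappa> (inv_into D \<kappa> x) \<bullet> b" k]
    by (simp add: f_inv_into_f)
qed

section \<open>Tangent vectors\<close>

lemma smooth_nearI: "openin M U \<Longrightarrow> p \<in> U \<Longrightarrow> smooth_fun A U f \<Longrightarrow> smooth_near M A p f"
  unfolding smooth_near_def by blast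

lemma smooth_near_cong:
  assumes "openin M U" "p \<in> U" "\<And>q. q \<in> U \<Longrightarrow> f q = h q" "smooth_near M A p f"
  shows "smooth_near M A p h"
proof -
  obtain V where V: "openin M V" "p \<in> V" "smooth_fun A V f"
    using assms(4) unfolding smooth_near_def by blast
  have "smooth_fun A (U \<inter> V) h"
    using smooth_fun_cong[of "U \<inter> V" f h] smooth_fun_subset[OF V(3), of "U \<inter> V"] assms(1,3) V(1)
    by auto
  then show ?thesis using assms(1,2) V by (intro smooth_nearI[of "U \<inter> V"]) auto
qed

text \<open>
  Two germs are defined on different neighbourhoods; an operation on them is performed on the
  intersection.
\<close>

lemma smooth_near_binary:
  assumes "\<And>U. openin M U \<Longrightarrow> smooth_fun A U f \<Longrightarrow> smooth_fun A U h \<Longrightarrow> smooth_fun A U k"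
    and "smooth_near M A p f" "smooth_near M A p h"
  shows "smooth_near M A p k"
proof -
  obtain U V where "openin M U" "p \<in> U" "smooth_fun A U f" "openin M V" "p \<in> V" "smooth_fun A V h"
    using assms(2,3) unfolding smooth_near_def by blast
  then show ?thesis
    using assms(1)[of "U \<inter> V"] smooth_fun_subset[of U f "U \<inter> V"] smooth_fun_subset[of V h "U \<inter> V"]
    by (intro smooth_nearI[of "U \<inter> V"]) auto
qed

lemma smooth_near_add: "smooth_near M A p f \<Longrightarrow> smooth_near M A p h \<Longrightarrow> smooth_near M A p (f + h)"
  by (rule smooth_near_binary[of f h]) (auto simp: plus_fun_def intro: smooth_fun_add)

lemma smooth_near_mult: "smooth_near M A p f \<Longrightarrow> smooth_near M A p h \<Longrightarrow> smooth_near M A p (f * h)"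
  by (rule smooth_near_binary[of f h]) (auto simp: times_fun_def intro: smooth_fun_mult)

lemma smooth_near_scale: "smooth_near M A p f \<Longrightarrow> smooth_near M A p (\<lambda>q. c * f q)"
  by (rule smooth_near_binary[of f f]) (auto intro: smooth_fun_mult smooth_fun_const)

lemma smooth_near_const: "p \<in> topspace M \<Longrightarrow> smooth_near M A p (\<lambda>q. c)"
  by (rule smooth_nearI[OF openin_topspace _ smooth_fun_const])

lemma tangent_space_iff:
  "v \<in> tangent_space M A p \<longleftrightarrow>
    (\<forall>f. \<not> smooth_near M A p f \<longrightarrow> v f = 0) \<and>
    (\<forall>f h. smooth_near M A p f \<and> smooth_near M A p h \<longrightarrow>
        v (f + h) = v f + v h \<and> v (f * h) = f p * v h + h p * v f) \<and>
    (\<forall>c f. smooth_near M A p f \<longrightarrow> v (\<lambda>q. c * f q) = c * v f) \<and>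
    (\<forall>U f h. openin M U \<and> p \<in> U \<and> smooth_near M A p f \<and> (\<forall>q\<in>U. f q = h q) \<longrightarrow> v f = v h)"
  unfolding tangent_space_def by (rule mem_Collect_eq)

lemma tangent_not_smooth: "v \<in> tangent_space M A p \<Longrightarrow> \<not> smooth_near M A p f \<Longrightarrow> v f = 0"
  by (drule iffD1[OF tangent_space_iff], elim conjE) simp

lemma tangent_add:
  "v \<in> tangent_space M A p \<Longrightarrow> smooth_near M A p f \<Longrightarrow> smooth_near M A p h \<Longrightarrow> v (f + h) = v f + v h"
  by (drule iffD1[OF tangent_space_iff], elim conjE) simp

lemma tangent_mult:
  "v \<in> tangent_space M A p \<Longrightarrow> smooth_near M A p f \<Longrightarrow> smooth_near M A p h \<Longrightarrow>
    v (f * h) = f p * v h + h p * v f"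
  by (drule iffD1[OF tangent_space_iff], elim conjE) simp

lemma tangent_scale: "v \<in> tangent_space M A p \<Longrightarrow> smooth_near M A p f \<Longrightarrow> v (\<lambda>q. c * f q) = c * v f"
  by (drule iffD1[OF tangent_space_iff], elim conjE) simp

text \<open>
  The values of tangent vectors depend on germs only, also for functions that are not smooth at \<open>p\<close>,
  on which tangent vectors take the default value \<open>0\<close>.
\<close>

lemma tangent_local:
  assumes v: "v \<in> tangent_space M A p" and U: "openin M U" "p \<in> U" and eq: "\<And>q. q \<in> U \<Longrightarrow> f q = h q"
  shows "v f = v h"
proof (cases "smooth_near M A p f")
  case True
  have "\<forall>U f h. openin M U \<and> p \<in> U \<and> smooth_near M A p f \<and> (\<forall>q\<in>U. f q = h q) \<longrightarrow> v f = v h"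
    using iffD1[OF tangent_space_iff v] by (elim conjE)
  from this[rule_format, of U f h] show ?thesis using True U eq by simp
next
  case False
  then have "\<not> smooth_near M A p h"
    using smooth_near_cong[OF U, of h f] eq by auto
  then show ?thesis using False tangent_not_smooth[OF v] by simp
qed

lemma tangent_spaceI:
  assumes "\<And>f. \<not> smooth_near M A p f \<Longrightarrow> v f = 0"
    and "\<And>f h. smooth_near M A p f \<Longrightarrow> smooth_near M A p h \<Longrightarrow> v (f + h) = v f + v h"
    and "\<And>f h. smooth_near M A p f \<Longrightarrow> smooth_near M A p h \<Longrightarrow> v (f * h) = f p * v h + h p * v f"
    and "\<And>c f. smooth_near M A p f \<Longrightarrow> v (\<lambda>q. c * f q) = c * v f"
    and "\<And>U f h. openin M U \<Longrightarrow> p \<in> U \<Longrightarrow> smooth_near M A p f \<Longrightarrow> (\<And>q. q \<in> U \<Longrightarrow> f q = h q) \<Longrightarrow> v f = v h"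
  shows "v \<in> tangent_space M A p"
proof (rule iffD2[OF tangent_space_iff], intro conjI allI impI; (elim conjE)?)
  fix U f h assume "openin M U" "p \<in> U" "smooth_near M A p f" "\<forall>q\<in>U. f q = h q"
  then show "v f = v h" by (intro assms(5)) auto
qed (rule assms; assumption)+

lemma tangent_space_add:
  assumes "u \<in> tangent_space M A p" "v \<in> tangent_space M A p"
  shows "u + v \<in> tangent_space M A p"
proof (rule tangent_spaceI)
  fix U f h assume "openin M U" "p \<in> U" "\<And>q. q \<in> U \<Longrightarrow> f q = (h q :: real)"
  then show "(u + v) f = (u + v) h"
    using tangent_local[OF assms(1), of U f h] tangent_local[OF assms(2), of U f h] by simp
qed (simp_all only: plus_fun_apply[of u v] tangent_add[OF assms(1)] tangent_add[OF assms(2)]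
    tangent_mult[OF assms(1)] tangent_mult[OF assms(2)]
    tangent_scale[OF assms(1)] tangent_scale[OF assms(2)] distrib_left add_ac,
    simp add: tangent_not_smooth[OF assms(1)] tangent_not_smooth[OF assms(2)])

lemma tangent_space_scale:
  assumes "u \<in> tangent_space M A p"
  shows "(\<lambda>f. c * u f) \<in> tangent_space M A p"
proof (rule tangent_spaceI)
  fix U f h assume "openin M U" "p \<in> U" "\<And>q. q \<in> U \<Longrightarrow> f q = (h q :: real)"
  then show "c * u f = c * u h"
    using tangent_local[OF assms, of U f h] by simp
qed (simp_all only: tangent_add[OF assms] tangent_mult[OF assms] tangent_scale[OF assms]
    distrib_left mult_ac, simp add: tangent_not_smooth[OF assms])

lemma tangent_space_zero: "0 \<in> tangent_space M A p"
  unfolding tangent_space_def by simp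

lemma tangent_space_sum:
  "(\<And>i. i \<in> I \<Longrightarrow> u i \<in> tangent_space M A p) \<Longrightarrow> (\<Sum>i\<in>I. u i) \<in> tangent_space M A p"
  by (induction I rule: infinite_finite_induct) (auto intro: tangent_space_zero tangent_space_add)

lemma tangent_const:
  assumes "v \<in> tangent_space M A p" "p \<in> topspace M"
  shows "v (\<lambda>q. c) = 0"
proof -
  note s = smooth_near_const[OF assms(2)]
  have "v ((\<lambda>q. 1) * (\<lambda>q. 1)) = v (\<lambda>q. 1) + v (\<lambda>q. 1)"
    using tangent_mult[OF assms(1) s s] by simp
  then have "v (\<lambda>q. 1) = 0" by (simp add: times_fun_def)
  then show ?thesis using tangent_scale[OF assms(1) s, of c 1] by simp
qed

lemma smooth_near_sum:
  assumes "p \<in> topspace M" "\<And>i. i \<in> I \<Longrightarrow> smooth_near M A p (f i)"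
  shows "smooth_near M A p (\<Sum>i\<in>I. f i)"
  using assms(2)
  by (induction I rule: infinite_finite_induct)
     (auto simp: smooth_near_add zero_fun_def smooth_near_const assms(1))

lemma tangent_sum:
  assumes "v \<in> tangent_space M A p" "p \<in> topspace M" "\<And>i. i \<in> I \<Longrightarrow> smooth_near M A p (f i)"
  shows "v (\<Sum>i\<in>I. f i) = (\<Sum>i\<in>I. v (f i))"
  using assms(3)
proof (induction I rule: infinite_finite_induct)
  case (insert i I)
  then show ?case
    using tangent_add[OF assms(1), of "f i" "\<Sum>i\<in>I. f i"] smooth_near_sum[OF assms(2), of I f]
    by (simp add: plus_fun_def)
qed (simp_all add: zero_fun_def tangent_const[OF assms(1,2)])

text \<open>
  This is the computation for which the Hadamard lemma is used: of the Leibniz rule for a product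
  \<open>f i * h i\<close> with \<open>f i\<close> vanishing at \<open>p\<close> only the term with \<open>v (f i)\<close> remains.
\<close>

lemma tangent_linear:
  assumes v: "v \<in> tangent_space M A p" and I: "finite I"
    and f: "\<And>i. i \<in> I \<Longrightarrow> smooth_near M A p (f i)" "\<And>i. i \<in> I \<Longrightarrow> f i p = 0"
    and h: "\<And>i. i \<in> I \<Longrightarrow> smooth_near M A p (h i)" and p: "p \<in> topspace M"
  shows "v ((\<lambda>q. c) + (\<Sum>i\<in>I. f i * h i)) = (\<Sum>i\<in>I. h i p * v (f i))"
proof -
  have "v ((\<lambda>q. c) + (\<Sum>i\<in>I. f i * h i)) = v (\<lambda>q. c) + v (\<Sum>i\<in>I. f i * h i)"
    using f h p by (intro tangent_add[OF v] smooth_near_const smooth_near_sum smooth_near_mult) auto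
  also have "\<dots> = (\<Sum>i\<in>I. v (f i * h i))"
    using tangent_sum[OF v p, of I "\<lambda>i. f i * h i"] tangent_const[OF v p] f h smooth_near_mult by simp
  also have "\<dots> = (\<Sum>i\<in>I. h i p * v (f i))"
    using tangent_mult[OF v f(1) h] f(2) by (intro sum.cong) auto
  finally show ?thesis .
qed

end

text \<open>
  The partial derivative along the basis vector \<open>b\<close> in the chart \<open>c\<close>. As for every tangent vector
  the value is \<open>0\<close> on functions that are not smooth near the point.
\<close>

definition coord_field ::
  "'a topology \<Rightarrow> ('a, 'e::euclidean_space) chart set \<Rightarrow> ('a, 'e) chart \<Rightarrow> 'e \<Rightarrow> 'a vfield" where
  "coord_field M A c b = (\<lambda>p f. if smooth_near M A p f
     then frechet_derivative (\<lambda>x. f (inv_into (fst c) (snd c) x)) (at (snd c p)) b else 0)"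

context smooth_atlas
begin

lemma smooth_near_differentiable:
  assumes c: "(D, \<kappa>) \<in> A" and p: "p \<in> D" and f: "smooth_near M A p f"
  shows "(\<lambda>x. f (inv_into D \<kappa> x)) differentiable (at (\<kappa> p))"
proof -
  obtain U where U: "p \<in> U" "smooth_fun A U f"
    using f unfolding smooth_near_def by blast
  from smooth_funD[OF U(2) c, of "Suc 0"] p U(1) show ?thesis by simp
qed

lemma coord_field_tangent:
  assumes c: "(D, \<kappa>) \<in> A" and p: "p \<in> D"
  shows "coord_field M A (D, \<kappa>) b p \<in> tangent_space M A p"
proof (rule tangent_spaceI)
  let ?v = "coord_field M A (D, \<kappa>) b p"
  note d = smooth_near_differentiable[OF c p, unfolded frechet_derivative_works]
  have v: "?v f = F b" if "smooth_near M A p f" "((\<lambda>x. f (inv_into D \<kappa> x)) has_derivative F) (at (\<kappa> p))" for f F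
    using that frechet_derivative_at[OF that(2)] by (simp add: coord_field_def)
  fix f assume f: "smooth_near M A p f"
  show "?v (\<lambda>q. r * f q) = r * ?v f" for r
    using v[OF smooth_near_scale[OF f] has_derivative_mult_right[OF d[OF f]]] v[OF f d[OF f]] by simp
  show "?v f = ?v h" if U: "openin M U" "p \<in> U" and eq: "\<And>q. q \<in> U \<Longrightarrow> f q = h q" for U h
  proof -
    have "((\<lambda>x. h (inv_into D \<kappa> x)) has_derivative
        frechet_derivative (\<lambda>x. f (inv_into D \<kappa> x)) (at (\<kappa> p))) (at (\<kappa> p))"
      by (rule has_derivative_transform_within_open[OF d[OF f] open_chart_image[OF c U(1)]])
         (use p U eq chart_inv[OF c] in auto)
    then show ?thesis
      using v[OF smooth_near_cong[OF U eq f]] v[OF f d[OF f]] by simp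
  qed
  fix h assume h: "smooth_near M A p h"
  show "?v (f + h) = ?v f + ?v h"
    using v[OF smooth_near_add[OF f h], unfolded plus_fun_apply, OF has_derivative_add[OF d[OF f] d[OF h]]]
      v[OF f d[OF f]] v[OF h d[OF h]] by (simp add: plus_fun_def)
  show "?v (f * h) = f p * ?v h + h p * ?v f"
    using v[OF smooth_near_mult[OF f h], unfolded times_fun_apply, OF has_derivative_mult[OF d[OF f] d[OF h]]]
      v[OF f d[OF f]] v[OF h d[OF h]] chart_inv[OF c p] by (simp add: times_fun_def)
qed (simp add: coord_field_def)

lemma coord_field_coordinate:
  assumes c: "(D, \<kappa>) \<in> A" and p: "p \<in> D"
  shows "coord_field M A (D, \<kappa>) b p (\<lambda>q. \<kappa> q \<bullet> b') = b \<bullet> b'"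
proof -
  have "((\<lambda>x. \<kappa> (inv_into D \<kappa> x) \<bullet> b') has_derivative (\<lambda>v. v \<bullet> b')) (at (\<kappa> p))"
    by (rule has_derivative_transform_within_open[OF
          has_derivative_inner_left[OF has_derivative_ident] chart_open_image[OF c]])
       (use p in \<open>auto simp: f_inv_into_f\<close>)
  from frechet_derivative_at[OF this, symmetric]
  show ?thesis
    using smooth_nearI[OF chart_openin[OF c] p smooth_fun_coordinate[OF c, of b']]
    by (simp add: coord_field_def)
qed

text \<open>
  The coordinate fields span the space of derivations. By the Hadamard lemma
  \<open>f = f p + (\<Sum>b. (x\<^sub>b - x\<^sub>b p) * h\<^sub>b)\<close> near \<open>p\<close>, where \<open>h\<^sub>b\<close> is smooth and takes at \<open>p\<close> the value of the partial
  derivative of \<open>f\<close>; now apply \<open>v\<close>.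
\<close>

lemma tangent_expansion:
  assumes c: "(D, \<kappa>) \<in> A" and p: "p \<in> D" and v: "v \<in> tangent_space M A p"
  shows "v f = (\<Sum>b\<in>Basis. v (\<lambda>q. \<kappa> q \<bullet> b) * coord_field M A (D, \<kappa>) b p f)"
proof (cases "smooth_near M A p f")
  case False
  then show ?thesis using tangent_not_smooth[OF v] by (simp add: coord_field_def)
next
  case True
  then obtain U where U: "openin M U" "p \<in> U" "smooth_fun A U f"
    unfolding smooth_near_def by blast
  have pM: "p \<in> topspace M" using openin_subset[OF U(1)] U(2) by blast
  let ?F = "\<lambda>x. f (inv_into D \<kappa> x)"
  have "\<kappa> p \<in> \<kappa> ` (D \<inter> U)" using p U(2) by blast
  then obtain r where r: "r > 0" "ball (\<kappa> p) r \<subseteq> \<kappa> ` (D \<inter> U)"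
    using open_chart_image[OF c U(1)] open_contains_ball by blast
  have "C_infinity ?F (ball (\<kappa> p) r)"
    unfolding C_infinity_def using C_k_subset[OF smooth_funD[OF U(3) c] r(2)] by blast
  from Hadamard[OF this] obtain h where h: "\<And>b. C_infinity (h b) (ball (\<kappa> p) r)"
    "\<And>x. x \<in> ball (\<kappa> p) r \<Longrightarrow> ?F x = ?F (\<kappa> p) + (\<Sum>b\<in>Basis. ((x - \<kappa> p) \<bullet> b) * h b x)"
    "\<And>b. h b (\<kappa> p) = frechet_derivative ?F (at (\<kappa> p)) b" by metis
  define V where "V = {q \<in> D. \<kappa> q \<in> ball (\<kappa> p) r}"
  have V: "openin M V" "p \<in> V" "V \<subseteq> D"
    using openin_chart_preimage[OF c open_ball] p r(1) by (auto simp: V_def)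
  have image_V: "\<kappa> ` V \<subseteq> ball (\<kappa> p) r" by (auto simp: V_def)
  have openV: "open (\<kappa> ` V)" using open_chart_image[OF c V(1)] V(3) by (simp add: Int_absorb1)
  have sh: "smooth_near M A p (\<lambda>q. h b (\<kappa> q))" for b
  proof (rule smooth_nearI[OF V(1,2) smooth_fun_chartI[OF c V(1,3)]])
    fix k
    have "C_k k (h b) (\<kappa> ` V)"
      using h(1)[of b] C_k_subset[OF _ image_V] unfolding C_infinity_def by blast
    moreover have "h b x = h b (\<kappa> (inv_into D \<kappa> x))" if "x \<in> \<kappa> ` V" for x
      using that V(3) by (metis f_inv_into_f image_mono subsetD)
    ultimately show "C_k k (\<lambda>x. h b (\<kappa> (inv_into D \<kappa> x))) (\<kappa> ` V)"
      by (rule C_k_congI[OF openV])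
  qed
  have sx: "smooth_near M A p (\<lambda>q. \<kappa> q \<bullet> b)" for b
    using smooth_nearI[OF chart_openin[OF c] p smooth_fun_coordinate[OF c]] .
  then have sx': "smooth_near M A p ((\<lambda>q. \<kappa> q \<bullet> b) + (\<lambda>q. - (\<kappa> p \<bullet> b)))" for b
    using smooth_near_add smooth_near_const[OF pM] by blast
  let ?x = "\<lambda>b. (\<lambda>q. \<kappa> q \<bullet> b) + (\<lambda>q. - (\<kappa> p \<bullet> b))"
  have "v f = v ((\<lambda>q. f p) + (\<Sum>b\<in>Basis. ?x b * (\<lambda>q. h b (\<kappa> q))))"
  proof (rule tangent_local[OF v V(1,2)])
    fix q assume q: "q \<in> V"
    then have "q \<in> D" using V(3) by blast
    have "\<kappa> q \<in> ball (\<kappa> p) r" using q by (simp add: V_def)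
    from h(2)[OF this]
    show "f q = ((\<lambda>q. f p) + (\<Sum>b\<in>Basis. ?x b * (\<lambda>q. h b (\<kappa> q)))) q"
      using chart_inv[OF c p] chart_inv[OF c \<open>q \<in> D\<close>] by (simp add: inner_diff_left sum_fun_apply)
  qed
  also have "\<dots> = (\<Sum>b\<in>Basis. h b (\<kappa> p) * v (?x b))"
    using tangent_linear[where f = ?x and h = "\<lambda>b q. h b (\<kappa> q)" and I = Basis, OF v _ sx' _ sh pM] by simp
  also have "\<dots> = (\<Sum>b\<in>Basis. v (\<lambda>q. \<kappa> q \<bullet> b) * coord_field M A (D, \<kappa>) b p f)"
  proof (rule sum.cong[OF refl])
    fix b
    have "v (?x b) = v (\<lambda>q. \<kappa> q \<bullet> b)"
      using tangent_add[OF v sx smooth_near_const[OF pM]] tangent_const[OF v pM] by simp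
    then show "h b (\<kappa> p) * v (?x b) = v (\<lambda>q. \<kappa> q \<bullet> b) * coord_field M A (D, \<kappa>) b p f"
      using True h(3) by (simp add: coord_field_def)
  qed
  finally show ?thesis .
qed

lemma smooth_fun_coord_field:
  assumes c: "(D, \<kappa>) \<in> A" and V: "openin M V" "V \<subseteq> D" and f: "smooth_fun A V f"
  shows "smooth_fun A V (\<lambda>p. coord_field M A (D, \<kappa>) b p f)"
proof (rule smooth_fun_chartI[OF c V])
  fix k
  have open_V: "open (\<kappa> ` V)" using open_chart_image[OF c V(1)] V(2) by (simp add: Int_absorb1)
  have "C_k (Suc k) (\<lambda>x. f (inv_into D \<kappa> x)) (\<kappa> ` V)"
    using smooth_funD[OF f c, of "Suc k"] V(2) by (simp add: Int_absorb1 del: C_k.simps)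
  then have "C_k k (\<lambda>x. frechet_derivative (\<lambda>x. f (inv_into D \<kappa> x)) (at x) b) (\<kappa> ` V)" by simp
  moreover have "frechet_derivative (\<lambda>x. f (inv_into D \<kappa> x)) (at x) b =
      coord_field M A (D, \<kappa>) b (inv_into D \<kappa> x) f" if "x \<in> \<kappa> ` V" for x
    using that chart_inv[OF c] V(2) smooth_nearI[OF V(1) _ f] by (auto simp: coord_field_def)
  ultimately show "C_k k (\<lambda>x. coord_field M A (D, \<kappa>) b (inv_into D \<kappa> x) f) (\<kappa> ` V)"
    by (rule C_k_congI[OF open_V])
qed

section \<open>Vector fields\<close>

lemma vfields_iff:
  "X \<in> vfields M A U \<longleftrightarrow> (\<forall>p\<in>U. X p \<in> tangent_space M A p) \<and>
     (\<forall>V f. openin M V \<and> V \<subseteq> U \<and> smooth_fun A V f \<longrightarrow> smooth_fun A V (\<lambda>p. X p f))"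
  unfolding vfields_def by (rule mem_Collect_eq)

lemma vfieldsI:
  assumes "\<And>p. p \<in> U \<Longrightarrow> X p \<in> tangent_space M A p"
    and "\<And>V f. openin M V \<Longrightarrow> V \<subseteq> U \<Longrightarrow> smooth_fun A V f \<Longrightarrow> smooth_fun A V (\<lambda>p. X p f)"
  shows "X \<in> vfields M A U"
  unfolding vfields_iff using assms by simp

lemma vfields_tangent: "X \<in> vfields M A U \<Longrightarrow> p \<in> U \<Longrightarrow> X p \<in> tangent_space M A p"
  unfolding vfields_iff by simp

lemma vfields_smooth:
  "X \<in> vfields M A U \<Longrightarrow> openin M V \<Longrightarrow> V \<subseteq> U \<Longrightarrow> smooth_fun A V f \<Longrightarrow> smooth_fun A V (\<lambda>p. X p f)"
  unfolding vfields_iff by simp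

lemma vfields_subset: "X \<in> vfields M A U \<Longrightarrow> V \<subseteq> U \<Longrightarrow> X \<in> vfields M A V"
  unfolding vfields_iff by auto

lemma vfields_cong:
  assumes "X \<in> vfields M A U" "\<And>p. p \<in> U \<Longrightarrow> X p = Y p"
  shows "Y \<in> vfields M A U"
proof (rule vfieldsI)
  fix V f assume V: "openin M V" "V \<subseteq> U" and f: "smooth_fun A V f"
  have "X p f = Y p f" if "p \<in> V" for p using assms(2) V(2) that by auto
  from smooth_fun_cong[OF V(1) this] show "smooth_fun A V (\<lambda>p. Y p f)"
    using vfields_smooth[OF assms(1) V f] by simp
qed (use vfields_tangent[OF assms(1)] assms(2) in simp)

lemma vfields_local:
  assumes "\<And>p. p \<in> U \<Longrightarrow> \<exists>V. openin M V \<and> p \<in> V \<and> X \<in> vfields M A V"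
  shows "X \<in> vfields M A U"
proof (rule vfieldsI)
  fix p assume "p \<in> U"
  then show "X p \<in> tangent_space M A p" using assms vfields_tangent by blast
next
  fix W f assume W: "openin M W" "W \<subseteq> U" and f: "smooth_fun A W f"
  show "smooth_fun A W (\<lambda>p. X p f)"
  proof (rule smooth_fun_local)
    fix p assume p: "p \<in> W"
    then obtain V where V: "openin M V" "p \<in> V" "X \<in> vfields M A V" using assms W(2) by blast
    have "smooth_fun A (V \<inter> W) (\<lambda>p. X p f)"
      using V W smooth_fun_subset[OF f] by (intro vfields_smooth[OF V(3)]) auto
    then show "\<exists>V. openin M V \<and> p \<in> V \<and> smooth_fun A V (\<lambda>p. X p f)"
      using V W p by (intro exI[of _ "V \<inter> W"]) auto
  qed
qed

lemma vfields_add: "X \<in> vfields M A U \<Longrightarrow> Y \<in> vfields M A U \<Longrightarrow> X + Y \<in> vfields M A U"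
  by (rule vfieldsI)
     (auto intro: tangent_space_add vfields_tangent smooth_fun_add vfields_smooth)

lemma vfields_fun_scale:
  "X \<in> vfields M A U \<Longrightarrow> smooth_fun A U h \<Longrightarrow> fun_scale h X \<in> vfields M A U"
  by (rule vfieldsI)
     (auto simp: fun_scale_def intro: tangent_space_scale vfields_tangent smooth_fun_mult vfields_smooth
        smooth_fun_subset)

lemma vfields_zero: "0 \<in> vfields M A U"
  by (rule vfieldsI) (auto intro: tangent_space_zero smooth_fun_const)

lemma vfields_uminus:
  assumes "X \<in> vfields M A U"
  shows "- X \<in> vfields M A U"
proof (rule vfields_cong[OF vfields_fun_scale[OF assms smooth_fun_const, of "-1"]])
qed (simp add: fun_scale_def fun_eq_iff)

lemma vfields_diff: "X \<in> vfields M A U \<Longrightarrow> Y \<in> vfields M A U \<Longrightarrow> X - Y \<in> vfields M A U"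
  using vfields_add[OF _ vfields_uminus, of X U Y] by simp

lemma vfields_sum: "(\<And>i. i \<in> I \<Longrightarrow> X i \<in> vfields M A U) \<Longrightarrow> (\<Sum>i\<in>I. X i) \<in> vfields M A U"
  by (induction I rule: infinite_finite_induct) (auto intro: vfields_zero vfields_add)

lemma coord_field_vfields:
  assumes "(D, \<kappa>) \<in> A"
  shows "coord_field M A (D, \<kappa>) b \<in> vfields M A D"
  using coord_field_tangent[OF assms] smooth_fun_coord_field[OF assms] by (intro vfieldsI)

text \<open>
  Combine the coordinate fields with constant coefficients.
\<close>

lemma tangent_extension:
  assumes p: "p \<in> topspace M" and v: "v \<in> tangent_space M A p"
  obtains V Z where "openin M V" "p \<in> V" "Z \<in> vfields M A V" "Z p = v"
proof -
  obtain D \<kappa> where c: "(D, \<kappa>) \<in> A" and pD: "p \<in> D" using chart_around[OF p] .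
  let ?Z = "\<Sum>b\<in>Basis. fun_scale (\<lambda>_. v (\<lambda>q. \<kappa> q \<bullet> b)) (coord_field M A (D, \<kappa>) b)"
  have "?Z \<in> vfields M A D"
    by (intro vfields_sum vfields_fun_scale coord_field_vfields[OF c] smooth_fun_const)
  moreover have "?Z p = v"
  proof
    fix f
    have "?Z p f = (\<Sum>b\<in>Basis. v (\<lambda>q. \<kappa> q \<bullet> b) * coord_field M A (D, \<kappa>) b p f)"
      by (simp add: sum_fun_apply fun_scale_def)
    also have "\<dots> = v f" by (rule tangent_expansion[OF c pD v, symmetric])
    finally show "?Z p f = v f" .
  qed
  ultimately show ?thesis using that[OF chart_openin[OF c] pD] by blast
qed

section \<open>Linear systems with smooth coefficients\<close>

lemma smooth_fun_det:
  assumes U: "openin M U" and a: "\<And>i j. i < n \<Longrightarrow> j < n \<Longrightarrow> smooth_fun A U (a i j)"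
  shows "smooth_fun A U (\<lambda>q. det (mat n n (\<lambda>(i, j). a i j q)))"
proof -
  have "det (mat n n (\<lambda>(i, j). a i j q)) =
      (\<Sum>\<pi> | \<pi> permutes {0..<n}. signof \<pi> * (\<Prod>i = 0..<n. a i (\<pi> i) q))" for q
    by (subst det_def') (auto intro!: sum.cong prod.cong dest: permutes_in_image)
  moreover have "smooth_fun A U
      (\<lambda>q. \<Sum>\<pi> | \<pi> permutes {0..<n}. signof \<pi> * (\<Prod>i = 0..<n. a i (\<pi> i) q))"
    by (intro smooth_fun_sum[OF U] smooth_fun_mult[OF U] smooth_fun_prod[OF U] smooth_fun_const a)
       (auto dest: permutes_in_image)
  ultimately show ?thesis by simp
qed

text \<open>
  A cofactor is up to sign the determinant of a matrix whose entries are among the \<open>a i j\<close>; the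
  function \<open>?s k\<close> in the proof enumerates the indices different from \<open>k\<close>.
\<close>

lemma smooth_fun_cofactor:
  assumes U: "openin M U" and a: "\<And>i j. i < n \<Longrightarrow> j < n \<Longrightarrow> smooth_fun A U (a i j)"
    and ij: "i < n" "j < n"
  shows "smooth_fun A U (\<lambda>q. cofactor (mat n n (\<lambda>(i, j). a i j q)) i j)"
proof -
  let ?s = "\<lambda>k l. if l < k then l else Suc l"
  have "cofactor (mat n n (\<lambda>(i, j). a i j q)) i j =
      (-1) ^ (i + j) * det (mat (n - 1) (n - 1) (\<lambda>(i', j'). a (?s i i') (?s j j') q))" for q
  proof -
    have "mat_delete (mat n n (\<lambda>(i, j). a i j q)) i j =
        mat (n - 1) (n - 1) (\<lambda>(i', j'). a (?s i i') (?s j j') q)"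
      by (rule eq_matI) (auto simp: mat_delete_def)
    then show ?thesis unfolding cofactor_def by simp
  qed
  moreover have "smooth_fun A U
      (\<lambda>q. (-1) ^ (i + j) * det (mat (n - 1) (n - 1) (\<lambda>(i', j'). a (?s i i') (?s j j') q)))"
    by (intro smooth_fun_mult[OF U] smooth_fun_const smooth_fun_det[OF U] a) auto
  ultimately show ?thesis by simp
qed

text \<open>
  Cramer's rule: the inverse matrix is the adjugate divided by the determinant, and both are
  polynomials in the entries.
\<close>

lemma smooth_linear_system:
  fixes n :: nat
  assumes U: "openin M U"
    and a: "\<And>i j. i < n \<Longrightarrow> j < n \<Longrightarrow> smooth_fun A U (a i j)"
    and b: "\<And>i. i < n \<Longrightarrow> smooth_fun A U (b i)"
    and regular: "\<And>q w j. q \<in> U \<Longrightarrow> (\<And>i. i < n \<Longrightarrow> (\<Sum>j<n. a i j q * w j) = 0) \<Longrightarrow> j < n \<Longrightarrow> w j = 0"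
  shows "\<exists>w. (\<forall>j<n. smooth_fun A U (w j)) \<and> (\<forall>q\<in>U. \<forall>i<n. (\<Sum>j<n. a i j q * w j q) = b i q)"
proof -
  let ?G = "\<lambda>q. mat n n (\<lambda>(i, j). a i j q)"
  let ?w = "\<lambda>j q. inverse (det (?G q)) * (\<Sum>k<n. cofactor (?G q) k j * b k q)"
  have G: "?G q \<in> carrier_mat n n" for q by simp
  have det: "det (?G q) \<noteq> 0" if q: "q \<in> U" for q
  proof
    assume "det (?G q) = 0"
    then obtain v where v: "v \<in> carrier_vec n" "v \<noteq> 0\<^sub>v n" "?G q *\<^sub>v v = 0\<^sub>v n"
      using det_0_iff_vec_prod_zero_field[OF G] by blast
    have "(\<Sum>j<n. a i j q * v $ j) = 0" if "i < n" for i
    proof -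
      have "(?G q *\<^sub>v v) $ i = (\<Sum>j<n. a i j q * v $ j)"
        using that v(1) by (auto simp: scalar_prod_def atLeast0LessThan intro!: sum.cong)
      then show ?thesis using v(3) that by simp
    qed
    then have "v $ j = 0" if "j < n" for j using regular[OF q, of "\<lambda>j. v $ j"] that by blast
    then have "v = 0\<^sub>v n" using v(1) by (intro eq_vecI) auto
    then show False using v(2) by simp
  qed
  have smooth_w: "smooth_fun A U (?w j)" if "j < n" for j
    using that det
    by (intro smooth_fun_mult[OF U] smooth_fun_inverse[OF U] smooth_fun_sum[OF U]
        smooth_fun_det[OF U] smooth_fun_cofactor[OF U] a b) auto
  have "(\<Sum>j<n. a i j q * ?w j q) = b i q" if q: "q \<in> U" and i: "i < n" for q i
  proof -
    have adj: "(\<Sum>j<n. a i j q * cofactor (?G q) k j) = (if i = k then det (?G q) else 0)" if "k < n" for k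
    proof -
      have "(?G q * adj_mat (?G q)) $$ (i, k) = (\<Sum>j<n. a i j q * cofactor (?G q) k j)"
        using i that by (auto simp: adj_mat_def scalar_prod_def atLeast0LessThan intro!: sum.cong)
      then show ?thesis using adj_mat(2)[OF G, of q] i that by (cases "i = k") simp_all
    qed
    have "(\<Sum>j<n. a i j q * ?w j q) =
        (\<Sum>j<n. \<Sum>k<n. inverse (det (?G q)) * (a i j q * cofactor (?G q) k j * b k q))"
      by (intro sum.cong refl) (simp add: sum_distrib_left mult_ac)
    also have "\<dots> = (\<Sum>k<n. \<Sum>j<n. inverse (det (?G q)) * (a i j q * cofactor (?G q) k j * b k q))"
      by (rule sum.swap)
    also have "\<dots> = inverse (det (?G q)) * (\<Sum>k<n. (\<Sum>j<n. a i j q * cofactor (?G q) k j) * b k q)"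
      by (simp only: sum_distrib_left sum_distrib_right)
    also have "(\<Sum>k<n. (\<Sum>j<n. a i j q * cofactor (?G q) k j) * b k q) =
        (\<Sum>k<n. if i = k then det (?G q) * b k q else 0)"
      by (rule sum.cong[OF refl]) (simp only: adj lessThan_iff if_distrib[of "\<lambda>x. x * _"] mult_zero_left)
    also have "\<dots> = det (?G q) * b i q" using i by simp
    finally show ?thesis using det[OF q] by simp
  qed
  then show ?thesis using smooth_w by (intro exI[of _ ?w]) blast
qed

end

section \<open>The isomorphism between one-forms and vector fields\<close>

locale pseudo_riemannian = smooth_atlas M A
  for M :: "'a topology" and A :: "('a, 'e::euclidean_space) chart set" +
  fixes g :: "'a metric_field"
  assumes metric: "pseudo_riemannian_metric M A g"
begin

lemma
  assumes p: "p \<in> topspace M" and u: "u \<in> tangent_space M A p"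
  shows metric_sym: "v \<in> tangent_space M A p \<Longrightarrow> g p u v = g p v u"
    and metric_add_left: "v \<in> tangent_space M A p \<Longrightarrow> w \<in> tangent_space M A p \<Longrightarrow>
      g p (u + v) w = g p u w + g p v w"
    and metric_scale_left: "v \<in> tangent_space M A p \<Longrightarrow> g p (\<lambda>f. c * u f) v = c * g p u v"
    and metric_nondegenerate: "(\<And>w. w \<in> tangent_space M A p \<Longrightarrow> g p u w = 0) \<Longrightarrow> u = 0"
proof -
  note * = bspec[OF conjunct1[OF metric[unfolded pseudo_riemannian_metric_def]] p]
  show "g p u v = g p v u" if "v \<in> tangent_space M A p"
    by (rule bspec[OF bspec[OF conjunct1[OF *] u] that])
  note * = conjunct2[OF *]
  show "g p (u + v) w = g p u w + g p v w"
    if "v \<in> tangent_space M A p" "w \<in> tangent_space M A p"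
    by (rule bspec[OF bspec[OF bspec[OF conjunct1[OF *] u] that(1)] that(2)])
  note * = conjunct2[OF *]
  show "g p (\<lambda>f. c * u f) v = c * g p u v" if "v \<in> tangent_space M A p"
    by (rule bspec[OF bspec[OF spec[OF conjunct1[OF *]] u] that])
  show "u = 0" if "\<And>w. w \<in> tangent_space M A p \<Longrightarrow> g p u w = 0"
    by (rule mp[OF bspec[OF conjunct2[OF *] u]]) (rule ballI, rule that)
qed

lemma metric_smooth:
  "openin M U \<Longrightarrow> X \<in> vfields M A U \<Longrightarrow> Y \<in> vfields M A U \<Longrightarrow> smooth_fun A U (mapply g X Y)"
  by (rule bspec[OF bspec[OF mp[OF spec[OF conjunct2[OF metric[unfolded pseudo_riemannian_metric_def]]]]]])

lemma metric_add_right: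
  assumes "p \<in> topspace M" "u \<in> tangent_space M A p" "v \<in> tangent_space M A p" "w \<in> tangent_space M A p"
  shows "g p w (u + v) = g p w u + g p w v"
  using metric_sym[OF assms(1,4) tangent_space_add[OF assms(2,3)]] metric_add_left[OF assms]
    metric_sym[OF assms(1,4,2)] metric_sym[OF assms(1,4,3)] by simp

lemma metric_scale_right:
  assumes "p \<in> topspace M" "u \<in> tangent_space M A p" "v \<in> tangent_space M A p"
  shows "g p u (\<lambda>f. c * v f) = c * g p u v"
  using metric_sym[OF assms(1,2) tangent_space_scale[OF assms(3)]] metric_sym[OF assms]
    metric_scale_left[OF assms(1,3,2)] by simp

lemma metric_zero_left:
  assumes "p \<in> topspace M" "w \<in> tangent_space M A p"
  shows "g p 0 w = 0"
  using metric_scale_left[OF assms(1) tangent_space_zero assms(2), of 0] by (simp add: zero_fun_def)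

lemma metric_sum_left:
  assumes "p \<in> topspace M" "w \<in> tangent_space M A p" "\<And>i. i \<in> I \<Longrightarrow> u i \<in> tangent_space M A p"
  shows "g p (\<Sum>i\<in>I. (\<lambda>f. c i * u i f)) w = (\<Sum>i\<in>I. c i * g p (u i) w)"
  using assms(3)
proof (induction I rule: infinite_finite_induct)
  case (insert i I)
  have "g p ((\<lambda>f. c i * u i f) + (\<Sum>i\<in>I. (\<lambda>f. c i * u i f))) w =
      g p (\<lambda>f. c i * u i f) w + g p (\<Sum>i\<in>I. (\<lambda>f. c i * u i f)) w"
    using insert.prems
    by (intro metric_add_left assms(1,2) tangent_space_sum tangent_space_scale insert.prems) auto
  then show ?case
    using insert metric_scale_left[OF assms(1) _ assms(2), of "u i" "c i"] by (simp add: plus_fun_def)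
qed (simp_all add: metric_zero_left assms)

text \<open>
  \<open>u\<close> is the Riesz representative of the one-form \<open>\<alpha>\<close> at \<open>p\<close>. All vector fields near \<open>p\<close> are used,
  without reference to the set on which \<open>\<alpha>\<close> is considered, so that one and the same vector field
  \<open>sharp \<alpha>\<close> serves for all open sets.
\<close>

definition represents :: "('a vfield \<Rightarrow> 'a \<Rightarrow> real) \<Rightarrow> 'a \<Rightarrow> 'a tangent \<Rightarrow> bool" where
  "represents \<alpha> p u \<longleftrightarrow> u \<in> tangent_space M A p \<and>
     (\<forall>V Z. openin M V \<and> p \<in> V \<and> Z \<in> vfields M A V \<longrightarrow> g p u (Z p) = \<alpha> Z p)"

definition sharp :: "('a vfield \<Rightarrow> 'a \<Rightarrow> real) \<Rightarrow> 'a vfield" where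
  "sharp \<alpha> p = (THE u. represents \<alpha> p u)"

text \<open>
  A one-form on \<open>U\<close>, given like the other tensors by its action on the vector fields on the open
  subsets of \<open>U\<close>.
\<close>

definition one_form :: "('a vfield \<Rightarrow> 'a \<Rightarrow> real) \<Rightarrow> 'a set \<Rightarrow> bool" where
  "one_form \<alpha> U \<longleftrightarrow>
     (\<forall>V Z. openin M V \<and> V \<subseteq> U \<and> Z \<in> vfields M A V \<longrightarrow> smooth_fun A V (\<alpha> Z)) \<and>
     (\<forall>V Z Z'. openin M V \<and> V \<subseteq> U \<and> Z \<in> vfields M A V \<and> Z' \<in> vfields M A V \<and> eq_on_set V Z Z' \<longrightarrow>
        eq_on_set V (\<alpha> Z) (\<alpha> Z')) \<and>
     (\<forall>V Z Z'. openin M V \<and> V \<subseteq> U \<and> Z \<in> vfields M A V \<and> Z' \<in> vfields M A V \<longrightarrow>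
        eq_on_set V (\<alpha> (Z + Z')) (\<alpha> Z + \<alpha> Z')) \<and>
     (\<forall>V Z h. openin M V \<and> V \<subseteq> U \<and> Z \<in> vfields M A V \<and> smooth_fun A V h \<longrightarrow>
        eq_on_set V (\<alpha> (fun_scale h Z)) (h * \<alpha> Z))"

text \<open>
  Nondegeneracy of the metric gives uniqueness, because every tangent vector at \<open>p\<close> is the value of a
  vector field near \<open>p\<close>.
\<close>

lemma represents_unique:
  assumes p: "p \<in> topspace M" and u: "represents \<alpha> p u" "represents \<alpha> p u'"
  shows "u = u'"
proof -
  have T: "u \<in> tangent_space M A p" "u' \<in> tangent_space M A p"
    using u by (simp_all add: represents_def)
  note T' = tangent_space_scale[OF T(2), of "-1"]
  have "u + (\<lambda>f. (-1) * u' f) = 0"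
  proof (rule metric_nondegenerate[OF p tangent_space_add[OF T(1) T']])
    fix w assume w: "w \<in> tangent_space M A p"
    obtain V Z where "openin M V" "p \<in> V" "Z \<in> vfields M A V" "Z p = w"
      using tangent_extension[OF p w] .
    then have "g p u w = g p u' w" using u unfolding represents_def by metis
    then show "g p (u + (\<lambda>f. (-1) * u' f)) w = 0"
      using metric_add_left[OF p T(1) T' w] metric_scale_left[OF p T(2) w, of "-1"] by simp
  qed
  note zero = fun_cong[OF this]
  show ?thesis
  proof
    fix f show "u f = u' f" using zero[of f] by simp
  qed
qed

lemma
  assumes \<alpha>: "one_form \<alpha> U" and V: "openin M V" "V \<subseteq> U" and Z: "Z \<in> vfields M A V"
  shows one_form_smooth: "smooth_fun A V (\<alpha> Z)"
    and one_form_cong: "Z' \<in> vfields M A V \<Longrightarrow> eq_on_set V Z Z' \<Longrightarrow> eq_on_set V (\<alpha> Z) (\<alpha> Z')"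
    and one_form_add: "Z' \<in> vfields M A V \<Longrightarrow> eq_on_set V (\<alpha> (Z + Z')) (\<alpha> Z + \<alpha> Z')"
    and one_form_scale: "smooth_fun A V h \<Longrightarrow> eq_on_set V (\<alpha> (fun_scale h Z)) (h * \<alpha> Z)"
proof -
  note * = \<alpha>[unfolded one_form_def]
  show "smooth_fun A V (\<alpha> Z)"
    by (rule mp[OF spec[OF spec[OF conjunct1[OF *], of V], of Z]]) (intro conjI V Z)
  note * = conjunct2[OF *]
  show "eq_on_set V (\<alpha> Z) (\<alpha> Z')" if "Z' \<in> vfields M A V" "eq_on_set V Z Z'"
    by (rule mp[OF spec[OF spec[OF spec[OF conjunct1[OF *], of V], of Z], of Z']]) (intro conjI V Z that)
  note * = conjunct2[OF *]
  show "eq_on_set V (\<alpha> (Z + Z')) (\<alpha> Z + \<alpha> Z')" if "Z' \<in> vfields M A V"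
    by (rule mp[OF spec[OF spec[OF spec[OF conjunct1[OF *], of V], of Z], of Z']]) (intro conjI V Z that)
  note * = conjunct2[OF *]
  show "eq_on_set V (\<alpha> (fun_scale h Z)) (h * \<alpha> Z)" if "smooth_fun A V h"
    by (rule mp[OF spec[OF spec[OF spec[OF *, of V], of Z], of h]]) (intro conjI V Z that)
qed

lemma one_form_combination:
  assumes \<alpha>: "one_form \<alpha> U" and V: "openin M V" "V \<subseteq> U" and p: "p \<in> V"
    and h: "\<And>i. i \<in> I \<Longrightarrow> smooth_fun A V (h i)" and X: "\<And>i. i \<in> I \<Longrightarrow> X i \<in> vfields M A V"
  shows "\<alpha> (\<Sum>i\<in>I. fun_scale (h i) (X i)) p = (\<Sum>i\<in>I. h i p * \<alpha> (X i) p)"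
proof -
  have hom: "\<alpha> (fun_scale k Z) p = k p * \<alpha> Z p" if "smooth_fun A V k" "Z \<in> vfields M A V" for k Z
    using eq_on_setD[OF one_form_scale[OF \<alpha> V that(2,1)] p] by simp
  have add: "\<alpha> (Z + Z') p = \<alpha> Z p + \<alpha> Z' p" if "Z \<in> vfields M A V" "Z' \<in> vfields M A V" for Z Z'
    using eq_on_setD[OF one_form_add[OF \<alpha> V that] p] by simp
  have zero: "\<alpha> 0 p = 0" using add[OF vfields_zero vfields_zero] by simp
  show ?thesis using h X
  proof (induction I rule: infinite_finite_induct)
    case (insert i I)
    then show ?case
      using add[of "fun_scale (h i) (X i)" "\<Sum>i\<in>I. fun_scale (h i) (X i)"] hom[of "h i" "X i"]
      by (simp add: vfields_fun_scale vfields_sum plus_fun_def)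
  qed (simp_all add: zero)
qed

lemma one_form_local:
  assumes "one_form \<alpha> U" "openin M V" "V \<subseteq> U" "p \<in> V" "Z \<in> vfields M A V" "\<And>q. q \<in> V \<Longrightarrow> Z q = Z' q"
  shows "\<alpha> Z p = \<alpha> Z' p"
  using eq_on_setD[OF one_form_cong[OF assms(1-3,5) vfields_cong[OF assms(5,6)]] assms(4)]
  by (simp add: eq_on_set_def assms(6))

text \<open>
  In a coordinate frame the representative is the solution of the linear system with the Gram matrix
  of the frame. This system is regular since the metric is nondegenerate and the frame spans the whole
  tangent space, hence its solution depends smoothly on the point.
\<close>

lemma represents_exists:
  assumes \<alpha>: "one_form \<alpha> U" and U: "openin M U" and p: "p \<in> U"
  obtains V X where "openin M V" "p \<in> V" "X \<in> vfields M A V" "\<And>q. q \<in> V \<Longrightarrow> represents \<alpha> q (X q)"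
proof -
  obtain D \<kappa> where c: "(D, \<kappa>) \<in> A" and pD: "p \<in> D"
    using chart_around openin_subset[OF U] p by blast
  define V where "V = U \<inter> D"
  have V: "openin M V" "p \<in> V" "V \<subseteq> U" "V \<subseteq> D" "V \<subseteq> topspace M"
    using p pD U chart_openin[OF c] openin_subset[OF U] by (auto simp: V_def)
  obtain bs :: "'e list" where bs: "set bs = Basis" "distinct bs"
    using finite_distinct_list[OF finite_Basis] by blast
  define n where "n = length bs"
  define E where "E i = coord_field M A (D, \<kappa>) (bs ! i)" for i
  define x where "x i = (\<lambda>q. \<kappa> q \<bullet> bs ! i)" for i
  have sum_bs: "(\<Sum>b\<in>Basis. F b) = (\<Sum>i<n. F (bs ! i))" for F :: "'e \<Rightarrow> real"
    using sum.reindex_bij_betw[OF bij_betw_nth[OF bs(2), of "{..<n}" Basis], of F] bs(1)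
    by (simp add: n_def)
  have E: "E i \<in> vfields M A V" for i
    unfolding E_def by (rule vfields_subset[OF coord_field_vfields[OF c] V(4)])
  have E_tangent: "E i q \<in> tangent_space M A q" if "q \<in> V" for i q
    using vfields_tangent[OF E that] .
  have E_x: "E i q (x j) = (if i = j then 1 else 0)" if "q \<in> V" "i < n" "j < n" for i j q
  proof -
    have "bs ! i \<in> Basis" "bs ! j \<in> Basis" "bs ! i = bs ! j \<longleftrightarrow> i = j"
      using that nth_mem[of i bs] nth_mem[of j bs] nth_eq_iff_index_eq[OF bs(2), of i j] bs(1)
      by (simp_all add: n_def)
    then show ?thesis
      using coord_field_coordinate[OF c, of q "bs ! i" "bs ! j"] subsetD[OF V(4) that(1)]
      by (simp add: E_def x_def inner_Basis)
  qed
  have expansion: "v = (\<Sum>i<n. (\<lambda>f. v (x i) * E i q f))" if q: "q \<in> V" and v: "v \<in> tangent_space M A q" for q v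
  proof
    fix f
    have "q \<in> D" using q V(4) by blast
    have "v f = (\<Sum>b\<in>Basis. v (\<lambda>q. \<kappa> q \<bullet> b) * coord_field M A (D, \<kappa>) b q f)"
      by (rule tangent_expansion[OF c \<open>q \<in> D\<close> v])
    also have "\<dots> = (\<Sum>i<n. v (x i) * E i q f)" unfolding sum_bs E_def x_def ..
    finally show "v f = (\<Sum>i<n. (\<lambda>f. v (x i) * E i q f)) f" by (simp add: sum_fun_apply)
  qed
  have x: "smooth_fun A W (x i)" if "W \<subseteq> D" for i W
    unfolding x_def by (rule smooth_fun_subset[OF smooth_fun_coordinate[OF c] that])
  have G: "smooth_fun A V (\<lambda>q. g q (E j q) (E i q))" for i j
    using metric_smooth[OF V(1) E E] by (simp add: mapply_def)
  have smooth_\<alpha>: "smooth_fun A V (\<alpha> (E i))" for i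
    by (rule one_form_smooth[OF \<alpha> V(1,3) E])
  \<comment> \<open>A vector in the kernel of the Gram matrix gives a tangent vector orthogonal to the whole tangent space.\<close>
  have regular: "w j = 0" if q: "q \<in> V" and zero: "\<And>i. i < n \<Longrightarrow> (\<Sum>j<n. g q (E j q) (E i q) * w j) = 0"
    and j: "j < n" for q w j
  proof -
    have qM: "q \<in> topspace M" using q V(5) by blast
    let ?u = "\<Sum>j<n. (\<lambda>f. w j * E j q f)"
    have uT: "?u \<in> tangent_space M A q"
      using E_tangent[OF q] by (intro tangent_space_sum tangent_space_scale)
    have uE: "g q ?u (E i q) = 0" if "i < n" for i
      using metric_sum_left[OF qM E_tangent[OF q] E_tangent[OF q], of w "\<lambda>j. j" "{..<n}" i] zero[OF that]
      by (simp add: mult.commute)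
    have "?u = 0"
    proof (rule metric_nondegenerate[OF qM uT])
      fix v assume v: "v \<in> tangent_space M A q"
      have "g q ?u v = g q v ?u" using metric_sym[OF qM uT v] .
      also have "\<dots> = g q (\<Sum>i<n. (\<lambda>f. v (x i) * E i q f)) ?u"
        using arg_cong[OF expansion[OF q v], of "\<lambda>v. g q v ?u"] .
        also have "\<dots> = (\<Sum>i<n. v (x i) * g q (E i q) ?u)"
        by (rule metric_sum_left[OF qM uT]) (rule E_tangent[OF q])
      also have "\<dots> = 0"
        using uE metric_sym[OF qM uT E_tangent[OF q]] by (intro sum.neutral) auto
      finally show "g q ?u v = 0" .
    qed
    then have "0 = ?u (x j)" by simp
    also have "\<dots> = (\<Sum>i<n. w i * E i q (x j))" by (simp only: sum_fun_apply)
    also have "\<dots> = (\<Sum>i<n. if i = j then w i else 0)"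
      by (rule sum.cong[OF refl]) (simp add: E_x[OF q _ j])
    finally show "w j = 0" using j by simp
  qed
  have "\<exists>w. (\<forall>j<n. smooth_fun A V (w j)) \<and>
      (\<forall>q\<in>V. \<forall>i<n. (\<Sum>j<n. g q (E j q) (E i q) * w j q) = \<alpha> (E i) q)"
    by (rule smooth_linear_system[OF V(1) G smooth_\<alpha>]) (rule regular)
  then obtain w where w: "\<And>j. j < n \<Longrightarrow> smooth_fun A V (w j)"
    and solution: "\<And>q i. q \<in> V \<Longrightarrow> i < n \<Longrightarrow> (\<Sum>j<n. g q (E j q) (E i q) * w j q) = \<alpha> (E i) q"
    by blast
  define X where "X = (\<Sum>j<n. fun_scale (w j) (E j))"
  have X: "X \<in> vfields M A V"
    unfolding X_def using w E by (intro vfields_sum vfields_fun_scale) auto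
  \<comment> \<open>The system says that \<open>X\<close> represents \<open>\<alpha>\<close> on the frame; expanding \<open>Z\<close> in the frame extends this to all \<open>Z\<close>.\<close>
  have "represents \<alpha> q (X q)" if q: "q \<in> V" for q
    unfolding represents_def
  proof (intro conjI allI impI; (elim conjE)?)
    show XT: "X q \<in> tangent_space M A q" using vfields_tangent[OF X q] .
    have qM: "q \<in> topspace M" using q V(5) by blast
    have Xq: "X q = (\<Sum>j<n. (\<lambda>f. w j q * E j q f))"
      by (simp add: X_def fun_eq_iff sum_fun_apply fun_scale_def)
    have XE: "g q (X q) (E i q) = \<alpha> (E i) q" if "i < n" for i
      unfolding Xq metric_sum_left[OF qM E_tangent[OF q] E_tangent[OF q]]
      using solution[OF q that] by (simp add: mult.commute)
    fix W Z assume W: "openin M W" "q \<in> W" and Z: "Z \<in> vfields M A W"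
    define W' where "W' = W \<inter> V"
    have W': "openin M W'" "W' \<subseteq> U" "W' \<subseteq> V" "W' \<subseteq> W" "q \<in> W'" "W' \<subseteq> D"
      using W V q by (auto simp: W'_def)
    have Z': "Z \<in> vfields M A W'" using vfields_subset[OF Z W'(4)] .
    have ZT: "Z r \<in> tangent_space M A r" if "r \<in> W'" for r using vfields_tangent[OF Z' that] .
    have "g q (X q) (Z q) = g q (Z q) (X q)" using metric_sym[OF qM XT ZT[OF W'(5)]] .
    also have "\<dots> = g q (\<Sum>i<n. (\<lambda>f. Z q (x i) * E i q f)) (X q)"
      using arg_cong[OF expansion[OF q ZT[OF W'(5)]], of "\<lambda>v. g q v (X q)"] .
    also have "\<dots> = (\<Sum>i<n. Z q (x i) * g q (E i q) (X q))"
      by (rule metric_sum_left[OF qM XT]) (rule E_tangent[OF q])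
    also have "\<dots> = (\<Sum>i<n. Z q (x i) * \<alpha> (E i) q)"
      using XE metric_sym[OF qM XT E_tangent[OF q]] by (intro sum.cong) auto
    also have "\<dots> = \<alpha> (\<Sum>i<n. fun_scale (\<lambda>r. Z r (x i)) (E i)) q"
      using one_form_combination[OF \<alpha> W'(1,2,5), of "{..<n}" "\<lambda>i r. Z r (x i)" E]
        vfields_smooth[OF Z' W'(1) order_refl x[OF W'(6)]] vfields_subset[OF E W'(3)] by simp
    also have "\<dots> = \<alpha> Z q"
    proof (rule one_form_local[OF \<alpha> W'(1,2,5), symmetric])
      fix r assume r: "r \<in> W'"
      then have "r \<in> V" using W'(3) by blast
      from expansion[OF this ZT[OF r]]
      show "Z r = (\<Sum>i<n. fun_scale (\<lambda>r. Z r (x i)) (E i)) r"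
        unfolding sum_fun_apply fun_scale_def .
    qed (rule Z')
    finally show "g q (X q) (Z q) = \<alpha> Z q" .
  qed
  then show ?thesis using that[OF V(1,2) X] by blast
qed

lemma
  assumes \<alpha>: "one_form \<alpha> U" and U: "openin M U"
  shows sharp_vfields: "sharp \<alpha> \<in> vfields M A U"
    and sharp_represents: "p \<in> U \<Longrightarrow> represents \<alpha> p (sharp \<alpha> p)"
proof -
  have sharp: "sharp \<alpha> q = u" if "q \<in> topspace M" "represents \<alpha> q u" for q u
    unfolding sharp_def using represents_unique[OF that(1)] that(2) by blast
  show "sharp \<alpha> \<in> vfields M A U"
  proof (rule vfields_local)
    fix p assume "p \<in> U"
    then obtain V X where V: "openin M V" "p \<in> V" and X: "X \<in> vfields M A V"
      and r: "\<And>q. q \<in> V \<Longrightarrow> represents \<alpha> q (X q)"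
      using represents_exists[OF \<alpha> U] by blast
    have "X q = sharp \<alpha> q" if "q \<in> V" for q
      using sharp[OF _ r[OF that]] openin_subset[OF V(1)] that by auto
    from vfields_cong[OF X this]
    show "\<exists>V. openin M V \<and> p \<in> V \<and> sharp \<alpha> \<in> vfields M A V" using V by blast
  qed
  assume p: "p \<in> U"
  then obtain V X where V: "openin M V" "p \<in> V" and X: "X \<in> vfields M A V"
    and r: "\<And>q. q \<in> V \<Longrightarrow> represents \<alpha> q (X q)"
    using represents_exists[OF \<alpha> U] by blast
  have "sharp \<alpha> p = X p" using sharp[OF _ r[OF V(2)]] openin_subset[OF U] p by blast
  then show "represents \<alpha> p (sharp \<alpha> p)" using r[OF V(2)] by simp
qed

end

section \<open>Products and connections at a fixed open set\<close>

lemma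
  assumes B: "local_biadditive M A B" and U: "openin M U"
    and X: "X \<in> vfields M A U" and Y: "Y \<in> vfields M A U"
  shows local_biadditive_vfields: "B X Y \<in> vfields M A U"
    and local_biadditive_cong: "X' \<in> vfields M A U \<Longrightarrow> Y' \<in> vfields M A U \<Longrightarrow>
      eq_on_set U X X' \<Longrightarrow> eq_on_set U Y Y' \<Longrightarrow> eq_on_set U (B X Y) (B X' Y')"
    and local_biadditive_left: "Z \<in> vfields M A U \<Longrightarrow> eq_on_set U (B (X + Y) Z) (B X Z + B Y Z)"
    and local_biadditive_right: "Z \<in> vfields M A U \<Longrightarrow> eq_on_set U (B Z (X + Y)) (B Z X + B Z Y)"
proof -
  note * = mp[OF spec[OF B[unfolded local_biadditive_def]] U]
  show "B X Y \<in> vfields M A U"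
    by (rule bspec[OF bspec[OF conjunct1[OF *] X] Y])
  note * = conjunct2[OF *]
  show "eq_on_set U (B X Y) (B X' Y')"
    if "X' \<in> vfields M A U" "Y' \<in> vfields M A U" "eq_on_set U X X'" "eq_on_set U Y Y'"
    by (rule mp[OF bspec[OF bspec[OF bspec[OF bspec[OF conjunct1[OF *] X] that(1)] Y] that(2)]])
       (intro conjI that)
  note * = bspec[OF bspec[OF bspec[OF conjunct2[OF *] X] Y]]
  show "eq_on_set U (B (X + Y) Z) (B X Z + B Y Z)" if "Z \<in> vfields M A U"
    by (rule conjunct1[OF *[OF that]])
  show "eq_on_set U (B Z (X + Y)) (B Z X + B Z Y)" if "Z \<in> vfields M A U"
    by (rule conjunct2[OF *[OF that]])
qed

lemma connection_biadditive: "connection M A D \<Longrightarrow> local_biadditive M A D"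
  unfolding connection_def by (rule conjunct1)

lemma
  assumes D: "connection M A D" and U: "openin M U"
    and X: "X \<in> vfields M A U" and Y: "Y \<in> vfields M A U" and h: "smooth_fun A U h"
  shows connection_scale_left: "eq_on_set U (D (fun_scale h X) Y) (fun_scale h (D X Y))"
    and connection_Leibniz:
      "eq_on_set U (D X (fun_scale h Y)) (fun_scale h (D X Y) + fun_scale (vapply X h) Y)"
proof -
  note * = mp[OF spec[OF bspec[OF bspec[OF
        mp[OF spec[OF conjunct2[OF D[unfolded connection_def]]] U] X] Y]] h]
  show "eq_on_set U (D (fun_scale h X) Y) (fun_scale h (D X Y))"
    by (rule conjunct1[OF *])
  show "eq_on_set U (D X (fun_scale h Y)) (fun_scale h (D X Y) + fun_scale (vapply X h) Y)"
    by (rule conjunct2[OF *])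
qed

lemma torsionlessD:
  assumes "torsionless M A D" "openin M U" "X \<in> vfields M A U" "Y \<in> vfields M A U"
  shows "eq_on_set U (D X Y - D Y X) (lie_bracket M A X Y)"
  by (rule bspec[OF bspec[OF mp[OF spec[OF assms(1)[unfolded torsionless_def]] assms(2)] assms(3)] assms(4)])

lemma smooth_bilinear_biadditive: "smooth_bilinear M A m \<Longrightarrow> local_biadditive M A m"
  unfolding smooth_bilinear_def by (rule conjunct1)

lemma
  assumes m: "smooth_bilinear M A m" and U: "openin M U"
    and X: "X \<in> vfields M A U" and Y: "Y \<in> vfields M A U" and h: "smooth_fun A U h"
  shows smooth_bilinear_scale_left: "eq_on_set U (m (fun_scale h X) Y) (fun_scale h (m X Y))"
    and smooth_bilinear_scale_right: "eq_on_set U (m X (fun_scale h Y)) (fun_scale h (m X Y))"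
proof -
  note * = mp[OF spec[OF bspec[OF bspec[OF
        mp[OF spec[OF conjunct2[OF m[unfolded smooth_bilinear_def]]] U] X] Y]] h]
  show "eq_on_set U (m (fun_scale h X) Y) (fun_scale h (m X Y))"
    by (rule conjunct1[OF *])
  show "eq_on_set U (m X (fun_scale h Y)) (fun_scale h (m X Y))"
    by (rule conjunct2[OF *])
qed

lemma unital_product_bilinear: "unital_product M A m e \<Longrightarrow> smooth_bilinear M A m"
  unfolding unital_product_def by (rule conjunct1)

lemma unital_product_unit: "unital_product M A m e \<Longrightarrow> e \<in> vfields M A (topspace M)"
  unfolding unital_product_def by (elim conjE)

lemma
  assumes m: "unital_product M A m e" and U: "openin M U"
    and X: "X \<in> vfields M A U" and Y: "Y \<in> vfields M A U"
  shows unital_product_commute: "eq_on_set U (m X Y) (m Y X)"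
    and unital_product_assoc: "Z \<in> vfields M A U \<Longrightarrow> eq_on_set U (m (m X Y) Z) (m X (m Y Z))"
    and unital_product_unit_left: "eq_on_set U (m e X) X"
proof -
  note * = bspec[OF bspec[OF
        mp[OF spec[OF conjunct2[OF conjunct2[OF m[unfolded unital_product_def]]]] U] X] Y]
  show "eq_on_set U (m X Y) (m Y X)"
    by (rule conjunct1[OF bspec[OF * X]])
  show "eq_on_set U (m e X) X"
    by (rule conjunct2[OF conjunct2[OF bspec[OF * X]]])
  show "eq_on_set U (m (m X Y) Z) (m X (m Y Z))" if "Z \<in> vfields M A U"
    by (rule conjunct1[OF conjunct2[OF bspec[OF * that]]])
qed

section \<open>The endomorphism dual to the exterior derivative of a one-form\<close>

locale torsionless_connection = pseudo_riemannian M A g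
  for M :: "'a topology" and A :: "('a, 'e::euclidean_space) chart set" and g :: "'a metric_field" +
  fixes D :: "'a vfield \<Rightarrow> 'a vfield \<Rightarrow> 'a vfield" and \<xi> :: "'a vfield"
  assumes connection: "connection M A D" and torsionless: "torsionless M A D"
    and \<xi>_vfield: "\<xi> \<in> vfields M A (topspace M)"
begin

abbreviation "\<theta> \<equiv> mapply g \<xi>"

abbreviation "d\<theta> \<equiv> ext_deriv M A \<theta>"

text \<open>
  \<open>(\<nabla>\<^sub>W \<theta>)(Z)\<close>. Since \<open>D\<close> is torsionless, \<open>d\<theta>(W, Z) = (\<nabla>\<^sub>W \<theta>)(Z) - (\<nabla>\<^sub>Z \<theta>)(W)\<close>, and this formula reduces the
  tensoriality of \<open>d\<theta>\<close> to that of \<open>\<nabla>\<theta>\<close>.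
\<close>

definition cov_deriv_form :: "'a vfield \<Rightarrow> 'a vfield \<Rightarrow> 'a \<Rightarrow> real" where
  "cov_deriv_form W Z p = W p (\<theta> Z) - \<theta> (D W Z) p"

lemma \<xi>_on: "openin M U \<Longrightarrow> \<xi> \<in> vfields M A U"
  using vfields_subset[OF \<xi>_vfield openin_subset] .

lemma D_vfields: "openin M U \<Longrightarrow> X \<in> vfields M A U \<Longrightarrow> Y \<in> vfields M A U \<Longrightarrow> D X Y \<in> vfields M A U"
  by (rule local_biadditive_vfields[OF connection_biadditive[OF connection]])

lemma \<theta>_smooth: "openin M U \<Longrightarrow> X \<in> vfields M A U \<Longrightarrow> smooth_fun A U (\<theta> X)"
  by (rule metric_smooth[OF _ \<xi>_on])

lemma
  assumes U: "openin M U" and p: "p \<in> U" and X: "X \<in> vfields M A U"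
  shows \<theta>_add: "Y \<in> vfields M A U \<Longrightarrow> \<theta> (X + Y) p = \<theta> X p + \<theta> Y p"
    and \<theta>_scale: "\<theta> (fun_scale h X) p = h p * \<theta> X p"
proof -
  have pM: "p \<in> topspace M" using openin_subset[OF U] p by blast
  note T = vfields_tangent[OF _ p]
  show "\<theta> (X + Y) p = \<theta> X p + \<theta> Y p" if "Y \<in> vfields M A U"
    using metric_add_right[OF pM T[OF X] T[OF that] T[OF \<xi>_on[OF U]]] by (simp add: mapply_def)
  show "\<theta> (fun_scale h X) p = h p * \<theta> X p"
    using metric_scale_right[OF pM T[OF \<xi>_on[OF U]] T[OF X]] by (simp add: mapply_def fun_scale_def)
qed

lemma
  assumes U: "openin M U" and p: "p \<in> U" and W: "W \<in> vfields M A U" and Z: "Z \<in> vfields M A U"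
  shows cov_deriv_form_cong: "W' \<in> vfields M A U \<Longrightarrow> Z' \<in> vfields M A U \<Longrightarrow>
      eq_on_set U W W' \<Longrightarrow> eq_on_set U Z Z' \<Longrightarrow> cov_deriv_form W Z p = cov_deriv_form W' Z' p"
    and cov_deriv_form_add_left: "W' \<in> vfields M A U \<Longrightarrow>
      cov_deriv_form (W + W') Z p = cov_deriv_form W Z p + cov_deriv_form W' Z p"
    and cov_deriv_form_add_right: "Z' \<in> vfields M A U \<Longrightarrow>
      cov_deriv_form W (Z + Z') p = cov_deriv_form W Z p + cov_deriv_form W Z' p"
    and cov_deriv_form_scale_left: "smooth_fun A U h \<Longrightarrow>
      cov_deriv_form (fun_scale h W) Z p = h p * cov_deriv_form W Z p"
    and cov_deriv_form_scale_right: "smooth_fun A U h \<Longrightarrow>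
      cov_deriv_form W (fun_scale h Z) p = h p * cov_deriv_form W Z p"
    and ext_deriv_eq: "d\<theta> W Z p = cov_deriv_form W Z p - cov_deriv_form Z W p"
proof -
  note B = connection_biadditive[OF connection]
  note T = vfields_tangent[OF _ p]
  note near = smooth_nearI[OF U p]
  note \<theta>_near = near[OF \<theta>_smooth[OF U]]
  have \<theta>_eq: "\<theta> X p = \<theta> Y p" if "eq_on_set U X Y" for X Y
    using eq_on_setD[OF that p] by (simp add: mapply_def)
  note DD = D_vfields[OF U]
  show "cov_deriv_form W Z p = cov_deriv_form W' Z' p"
    if W': "W' \<in> vfields M A U" "Z' \<in> vfields M A U" and eq: "eq_on_set U W W'" "eq_on_set U Z Z'"
  proof -
    have "W p (\<theta> Z) = W p (\<theta> Z')"
      by (rule tangent_local[OF T[OF W] U p]) (simp add: mapply_def eq_on_setD[OF eq(2)])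
    then show ?thesis
      using \<theta>_eq[OF local_biadditive_cong[OF B U W Z W' eq]] eq_on_setD[OF eq(1) p]
      by (simp add: cov_deriv_form_def)
  qed
  show "cov_deriv_form (W + W') Z p = cov_deriv_form W Z p + cov_deriv_form W' Z p"
    if W': "W' \<in> vfields M A U"
    using \<theta>_eq[OF local_biadditive_left[OF B U W W' Z]] \<theta>_add[OF U p DD[OF W Z] DD[OF W' Z]]
    by (simp add: cov_deriv_form_def)
  show "cov_deriv_form W (Z + Z') p = cov_deriv_form W Z p + cov_deriv_form W Z' p"
    if Z': "Z' \<in> vfields M A U"
  proof -
    have "W p (\<theta> (Z + Z')) = W p (\<theta> Z + \<theta> Z')"
      by (rule tangent_local[OF T[OF W] U p]) (simp add: \<theta>_add[OF U _ Z Z'])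
    then show ?thesis
      using \<theta>_eq[OF local_biadditive_right[OF B U Z Z' W]] \<theta>_add[OF U p DD[OF W Z] DD[OF W Z']]
        tangent_add[OF T[OF W] \<theta>_near[OF Z] \<theta>_near[OF Z']]
      by (simp add: cov_deriv_form_def)
  qed
  show "cov_deriv_form (fun_scale h W) Z p = h p * cov_deriv_form W Z p" if h: "smooth_fun A U h"
    using \<theta>_eq[OF connection_scale_left[OF connection U W Z h]] \<theta>_scale[OF U p DD[OF W Z]]
    by (simp add: cov_deriv_form_def fun_scale_def[of h W] right_diff_distrib)
  show "cov_deriv_form W (fun_scale h Z) p = h p * cov_deriv_form W Z p" if h: "smooth_fun A U h"
  proof -
    have Wh: "smooth_fun A U (vapply W h)"
      using vfields_smooth[OF W U order_refl h] by (simp add: vapply_def)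
    have "W p (\<theta> (fun_scale h Z)) = W p (h * \<theta> Z)"
      by (rule tangent_local[OF T[OF W] U p]) (simp add: \<theta>_scale[OF U _ Z])
    also have "\<dots> = h p * W p (\<theta> Z) + \<theta> Z p * W p h"
      by (rule tangent_mult[OF T[OF W] near[OF h] \<theta>_near[OF Z]])
    finally show ?thesis
      using \<theta>_eq[OF connection_Leibniz[OF connection U W Z h]]
        \<theta>_add[OF U p vfields_fun_scale[OF DD[OF W Z] h] vfields_fun_scale[OF Z Wh]]
        \<theta>_scale[OF U p DD[OF W Z], of h] \<theta>_scale[OF U p Z, of "vapply W h"]
      by (simp add: cov_deriv_form_def vapply_def right_diff_distrib)
  qed
  show "d\<theta> W Z p = cov_deriv_form W Z p - cov_deriv_form Z W p"
  proof -
    have minus: "D W Z - D Z W = D W Z + fun_scale (\<lambda>_. -1) (D Z W)"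
      by (simp add: fun_scale_def fun_eq_iff)
    have "\<theta> (lie_bracket M A W Z) p = \<theta> (D W Z - D Z W) p"
      by (rule \<theta>_eq[OF torsionlessD[OF torsionless U W Z], symmetric])
    also have "\<dots> = \<theta> (D W Z + fun_scale (\<lambda>_. -1) (D Z W)) p"
      by (simp only: minus)
    also have "\<dots> = \<theta> (D W Z) p + \<theta> (fun_scale (\<lambda>_. -1) (D Z W)) p"
      by (rule \<theta>_add[OF U p DD[OF W Z] vfields_fun_scale[OF DD[OF Z W] smooth_fun_const]])
    also have "\<dots> = \<theta> (D W Z) p - \<theta> (D Z W) p"
      using \<theta>_scale[OF U p DD[OF Z W], of "\<lambda>_. -1"] by simp
    finally show ?thesis by (simp add: ext_deriv_def cov_deriv_form_def vapply_def)
  qed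
qed

lemma cov_deriv_form_smooth:
  assumes U: "openin M U" and W: "W \<in> vfields M A U" and Z: "Z \<in> vfields M A U"
  shows "smooth_fun A U (cov_deriv_form W Z)"
proof -
  have "smooth_fun A U (\<lambda>p. W p (\<theta> Z) + (-1) * \<theta> (D W Z) p)"
    by (intro smooth_fun_add[OF U] smooth_fun_mult[OF U] smooth_fun_const
        vfields_smooth[OF W U order_refl] \<theta>_smooth[OF U] D_vfields[OF U] W Z)
  moreover have "cov_deriv_form W Z = (\<lambda>p. W p (\<theta> Z) + (-1) * \<theta> (D W Z) p)"
    by (rule ext) (simp add: cov_deriv_form_def)
  ultimately show ?thesis by simp
qed

lemma
  assumes U: "openin M U" and p: "p \<in> U" and W: "W \<in> vfields M A U" and Z: "Z \<in> vfields M A U"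
  shows ext_deriv_cong: "W' \<in> vfields M A U \<Longrightarrow> Z' \<in> vfields M A U \<Longrightarrow>
      eq_on_set U W W' \<Longrightarrow> eq_on_set U Z Z' \<Longrightarrow> d\<theta> W Z p = d\<theta> W' Z' p"
    and ext_deriv_skew: "d\<theta> W Z p = - d\<theta> Z W p"
    and ext_deriv_add_left: "W' \<in> vfields M A U \<Longrightarrow> d\<theta> (W + W') Z p = d\<theta> W Z p + d\<theta> W' Z p"
    and ext_deriv_add_right: "Z' \<in> vfields M A U \<Longrightarrow> d\<theta> W (Z + Z') p = d\<theta> W Z p + d\<theta> W Z' p"
    and ext_deriv_scale_left: "smooth_fun A U h \<Longrightarrow> d\<theta> (fun_scale h W) Z p = h p * d\<theta> W Z p"
    and ext_deriv_scale_right: "smooth_fun A U h \<Longrightarrow> d\<theta> W (fun_scale h Z) p = h p * d\<theta> W Z p"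
proof -
  note eq = ext_deriv_eq[OF U p]
  note N = cov_deriv_form_add_left[OF U p] cov_deriv_form_add_right[OF U p]
    cov_deriv_form_scale_left[OF U p] cov_deriv_form_scale_right[OF U p]
  show "d\<theta> W Z p = d\<theta> W' Z' p"
    if "W' \<in> vfields M A U" "Z' \<in> vfields M A U" "eq_on_set U W W'" "eq_on_set U Z Z'"
    using cov_deriv_form_cong[OF U p W Z that] cov_deriv_form_cong[OF U p Z W that(2,1,4,3)]
    by (simp only: eq[OF W Z] eq[OF that(1,2)])
  show "d\<theta> W Z p = - d\<theta> Z W p" by (simp add: eq[OF W Z] eq[OF Z W])
  show "d\<theta> (W + W') Z p = d\<theta> W Z p + d\<theta> W' Z p" if W': "W' \<in> vfields M A U"
    by (simp add: eq[OF vfields_add[OF W W'] Z] eq[OF W Z] eq[OF W' Z] N(1)[OF W Z W'] N(2)[OF Z W W'])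
  show "d\<theta> W (Z + Z') p = d\<theta> W Z p + d\<theta> W Z' p" if Z': "Z' \<in> vfields M A U"
    by (simp add: eq[OF W vfields_add[OF Z Z']] eq[OF W Z] eq[OF W Z'] N(2)[OF W Z Z'] N(1)[OF Z W Z'])
  show "d\<theta> (fun_scale h W) Z p = h p * d\<theta> W Z p" if h: "smooth_fun A U h"
    by (simp add: eq[OF vfields_fun_scale[OF W h] Z] eq[OF W Z] N(3)[OF W Z h] N(4)[OF Z W h] right_diff_distrib)
  show "d\<theta> W (fun_scale h Z) p = h p * d\<theta> W Z p" if h: "smooth_fun A U h"
    by (simp add: eq[OF W vfields_fun_scale[OF Z h]] eq[OF W Z] N(4)[OF W Z h] N(3)[OF Z W h] right_diff_distrib)
qed

definition half_d :: "'a vfield \<Rightarrow> 'a vfield \<Rightarrow> 'a \<Rightarrow> real" where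
  "half_d W Z p = 1 / 2 * d\<theta> W Z p"

text \<open>
  The endomorphism determined by \<open>g(\<Phi> W, Z) = d\<theta>(W, Z) / 2\<close>.
\<close>

definition \<Phi> :: "'a vfield \<Rightarrow> 'a vfield" where
  "\<Phi> W = sharp (half_d W)"

lemma one_form_half_d:
  assumes U: "openin M U" and W: "W \<in> vfields M A U"
  shows "one_form (half_d W) U"
  unfolding one_form_def
proof (intro conjI allI impI; (elim conjE)?)
  fix V Z assume V: "openin M V" "V \<subseteq> U" and Z: "Z \<in> vfields M A V"
  note W' = vfields_subset[OF W V(2)]
  have "smooth_fun A V (\<lambda>p. (1 / 2) * (cov_deriv_form W Z p + (-1) * cov_deriv_form Z W p))"
    by (intro smooth_fun_add[OF V(1)] smooth_fun_mult[OF V(1)] smooth_fun_const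
        cov_deriv_form_smooth[OF V(1)] W' Z)
  moreover have "(1 / 2) * (cov_deriv_form W Z p + (-1) * cov_deriv_form Z W p) = half_d W Z p"
    if "p \<in> V" for p
    by (simp add: half_d_def ext_deriv_eq[OF V(1) that W' Z])
  note smooth_fun_cong[OF V(1) this]
  ultimately show "smooth_fun A V (half_d W Z)" by simp
next
  fix V Z Z' assume V: "openin M V" "V \<subseteq> U" and Z: "Z \<in> vfields M A V" "Z' \<in> vfields M A V"
  note W' = vfields_subset[OF W V(2)]
  show "eq_on_set V (half_d W (Z + Z')) (half_d W Z + half_d W Z')"
    by (rule eq_on_setI) (simp add: half_d_def ext_deriv_add_right[OF V(1) _ W' Z])
  assume "eq_on_set V Z Z'"
  then show "eq_on_set V (half_d W Z) (half_d W Z')"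
    by (intro eq_on_setI)
       (simp add: half_d_def ext_deriv_cong[OF V(1) _ W' Z(1) W' Z(2)] eq_on_set_def)
next
  fix V Z h assume V: "openin M V" "V \<subseteq> U" and Z: "Z \<in> vfields M A V" and h: "smooth_fun A V h"
  show "eq_on_set V (half_d W (fun_scale h Z)) (h * half_d W Z)"
    by (rule eq_on_setI)
       (simp add: half_d_def ext_deriv_scale_right[OF V(1) _ vfields_subset[OF W V(2)] Z h])
qed

lemma \<Phi>_vfields: "openin M U \<Longrightarrow> W \<in> vfields M A U \<Longrightarrow> \<Phi> W \<in> vfields M A U"
  unfolding \<Phi>_def by (rule sharp_vfields[OF one_form_half_d])

lemma metric_\<Phi>:
  assumes U: "openin M U" and p: "p \<in> U" and W: "W \<in> vfields M A U" and Z: "Z \<in> vfields M A U"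
  shows "g p (\<Phi> W p) (Z p) = 1 / 2 * d\<theta> W Z p"
  using sharp_represents[OF one_form_half_d[OF U W] U p] U p Z
  unfolding represents_def \<Phi>_def[symmetric] half_d_def[symmetric] by simp

text \<open>
  The algebraic properties of \<open>\<Phi>\<close> follow from those of \<open>d\<theta>\<close> by uniqueness of representatives.
\<close>

lemma \<Phi>_eqI:
  assumes U: "openin M U" and p: "p \<in> U" and W: "W \<in> vfields M A U" and u: "u \<in> tangent_space M A p"
    and eq: "\<And>V Z. openin M V \<Longrightarrow> V \<subseteq> U \<Longrightarrow> p \<in> V \<Longrightarrow> Z \<in> vfields M A V \<Longrightarrow>
      g p u (Z p) = 1 / 2 * d\<theta> W Z p"
  shows "\<Phi> W p = u"
proof (rule represents_unique)
  show "p \<in> topspace M" using openin_subset[OF U] p by blast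
  show "represents (half_d W) p (\<Phi> W p)"
    unfolding \<Phi>_def by (rule sharp_represents[OF one_form_half_d[OF U W] U p])
  show "represents (half_d W) p u"
    unfolding represents_def
  proof (intro conjI allI impI u; (elim conjE)?)
    fix V Z assume V: "openin M V" "p \<in> V" and Z: "Z \<in> vfields M A V"
    show "g p u (Z p) = half_d W Z p"
      unfolding half_d_def using eq[of "U \<inter> V" Z] vfields_subset[OF Z, of "U \<inter> V"] U V p by auto
  qed
qed

lemma
  assumes U: "openin M U" and W: "W \<in> vfields M A U"
  shows \<Phi>_cong: "W' \<in> vfields M A U \<Longrightarrow> eq_on_set U W W' \<Longrightarrow> eq_on_set U (\<Phi> W) (\<Phi> W')"
    and \<Phi>_add: "W' \<in> vfields M A U \<Longrightarrow> eq_on_set U (\<Phi> (W + W')) (\<Phi> W + \<Phi> W')"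
    and \<Phi>_scale: "smooth_fun A U h \<Longrightarrow> eq_on_set U (\<Phi> (fun_scale h W)) (fun_scale h (\<Phi> W))"
proof -
  note \<Phi> = \<Phi>_vfields[OF U]
  show "eq_on_set U (\<Phi> W) (\<Phi> W')" if W': "W' \<in> vfields M A U" and eq: "eq_on_set U W W'"
  proof (intro eq_on_setI \<Phi>_eqI[OF U _ W])
    fix p assume p: "p \<in> U"
    show "\<Phi> W' p \<in> tangent_space M A p" using vfields_tangent[OF \<Phi>[OF W'] p] .
    fix V Z assume V: "openin M V" "V \<subseteq> U" "p \<in> V" and Z: "Z \<in> vfields M A V"
    have "d\<theta> W' Z p = d\<theta> W Z p"
      by (rule ext_deriv_cong[OF V(1,3) vfields_subset[OF W' V(2)] Z vfields_subset[OF W V(2)] Z])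
         (use eq V(2) in \<open>auto simp: eq_on_set_def\<close>)
    then show "g p (\<Phi> W' p) (Z p) = 1 / 2 * d\<theta> W Z p"
      using metric_\<Phi>[OF V(1,3) vfields_subset[OF W' V(2)] Z] by simp
  qed
  show "eq_on_set U (\<Phi> (W + W')) (\<Phi> W + \<Phi> W')" if W': "W' \<in> vfields M A U"
  proof (intro eq_on_setI \<Phi>_eqI[OF U _ vfields_add[OF W W']])
    fix p assume p: "p \<in> U"
    show "(\<Phi> W + \<Phi> W') p \<in> tangent_space M A p"
      by (rule vfields_tangent[OF vfields_add[OF \<Phi>[OF W] \<Phi>[OF W']] p])
    fix V Z assume V: "openin M V" "V \<subseteq> U" "p \<in> V" and Z: "Z \<in> vfields M A V"
    note WV = vfields_subset[OF W V(2)] vfields_subset[OF W' V(2)]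
    have pM: "p \<in> topspace M" using openin_subset[OF U] p by blast
    show "g p ((\<Phi> W + \<Phi> W') p) (Z p) = 1 / 2 * d\<theta> (W + W') Z p"
      using metric_add_left[OF pM vfields_tangent[OF \<Phi>[OF W] p] vfields_tangent[OF \<Phi>[OF W'] p]
          vfields_tangent[OF Z V(3)]]
        metric_\<Phi>[OF V(1,3) WV(1) Z] metric_\<Phi>[OF V(1,3) WV(2) Z]
        ext_deriv_add_left[OF V(1,3) WV(1) Z WV(2)] by (simp only: plus_fun_apply) (simp add: field_simps)
  qed
  show "eq_on_set U (\<Phi> (fun_scale h W)) (fun_scale h (\<Phi> W))" if h: "smooth_fun A U h"
  proof (intro eq_on_setI \<Phi>_eqI[OF U _ vfields_fun_scale[OF W h]])
    fix p assume p: "p \<in> U"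
    show "fun_scale h (\<Phi> W) p \<in> tangent_space M A p"
      by (rule vfields_tangent[OF vfields_fun_scale[OF \<Phi>[OF W] h] p])
    fix V Z assume V: "openin M V" "V \<subseteq> U" "p \<in> V" and Z: "Z \<in> vfields M A V"
    note WV = vfields_subset[OF W V(2)]
    have pM: "p \<in> topspace M" using openin_subset[OF U] p by blast
    show "g p (fun_scale h (\<Phi> W) p) (Z p) = 1 / 2 * d\<theta> (fun_scale h W) Z p"
      using metric_scale_left[OF pM vfields_tangent[OF \<Phi>[OF W] p] vfields_tangent[OF Z V(3)]]
        metric_\<Phi>[OF V(1,3) WV Z] ext_deriv_scale_left[OF V(1,3) WV Z smooth_fun_subset[OF h V(2)]]
      by (simp add: fun_scale_def[of h "\<Phi> W"])
  qed
qed

end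

section \<open>The algebra of flat F-manifolds\<close>

text \<open>
  The vector fields on a fixed open set with the operations \<open>m\<close> and \<open>D\<close>, reduced to what the two
  identities below use. The carrier \<open>V\<close> is a subset of the type because the operations on vector
  fields obey these laws only for smooth fields.
\<close>

locale flat_F_algebra =
  fixes V :: "'v::ab_group_add set" and m D :: "'v \<Rightarrow> 'v \<Rightarrow> 'v"
  assumes add_closed: "x \<in> V \<Longrightarrow> y \<in> V \<Longrightarrow> x + y \<in> V"
    and uminus_closed: "x \<in> V \<Longrightarrow> - x \<in> V"
    and m_closed: "x \<in> V \<Longrightarrow> y \<in> V \<Longrightarrow> m x y \<in> V"
    and D_closed: "x \<in> V \<Longrightarrow> y \<in> V \<Longrightarrow> D x y \<in> V"
    and m_add: "x \<in> V \<Longrightarrow> y \<in> V \<Longrightarrow> z \<in> V \<Longrightarrow> m x (y + z) = m x y + m x z"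
    and D_add_right: "x \<in> V \<Longrightarrow> y \<in> V \<Longrightarrow> z \<in> V \<Longrightarrow> D x (y + z) = D x y + D x z"
    and m_commute: "x \<in> V \<Longrightarrow> y \<in> V \<Longrightarrow> m x y = m y x"
    and m_assoc: "x \<in> V \<Longrightarrow> y \<in> V \<Longrightarrow> z \<in> V \<Longrightarrow> m (m x y) z = m x (m y z)"
    and compatible: "x \<in> V \<Longrightarrow> y \<in> V \<Longrightarrow> z \<in> V \<Longrightarrow>
      D x (m y z) - m (D x y) z - m y (D x z) = D y (m x z) - m (D y x) z - m x (D y z)"
    and flat: "x \<in> V \<Longrightarrow> y \<in> V \<Longrightarrow> z \<in> V \<Longrightarrow>
      D x (D y z) - D y (D x z) - D (D x y - D y x) z = 0"
begin

text \<open>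
  The covariant derivative \<open>(\<nabla>\<^sub>x c)(y, z)\<close> of the product.
\<close>

definition C :: "'v \<Rightarrow> 'v \<Rightarrow> 'v \<Rightarrow> 'v" where
  "C x y z = D x (m y z) - m (D x y) z - m y (D x z)"

definition bracket :: "'v \<Rightarrow> 'v \<Rightarrow> 'v" where
  "bracket x y = D x y - D y x"

text \<open>
  The Lie derivative \<open>(\<L>\<^sub>x c)(y, z)\<close> of the product.
\<close>

definition lie_product :: "'v \<Rightarrow> 'v \<Rightarrow> 'v \<Rightarrow> 'v" where
  "lie_product x y z = bracket x (m y z) - m (bracket x y) z - m y (bracket x z)"

lemma diff_closed: "x \<in> V \<Longrightarrow> y \<in> V \<Longrightarrow> x - y \<in> V"
  using add_closed[OF _ uminus_closed] by fastforce

lemmas closed = add_closed diff_closed m_closed D_closed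

lemma m_diff: "x \<in> V \<Longrightarrow> y \<in> V \<Longrightarrow> z \<in> V \<Longrightarrow> m x (y - z) = m x y - m x z"
  using m_add[of x "y - z" z] by (simp add: closed)

lemma m_add_left: "x \<in> V \<Longrightarrow> y \<in> V \<Longrightarrow> z \<in> V \<Longrightarrow> m (y + z) x = m y x + m z x"
  using m_add[of x y z] by (simp add: m_commute[of _ x] closed)

lemma m_diff_left: "x \<in> V \<Longrightarrow> y \<in> V \<Longrightarrow> z \<in> V \<Longrightarrow> m (y - z) x = m y x - m z x"
  using m_diff[of x y z] by (simp add: m_commute[of _ x] closed)

lemma m_left_commute: "x \<in> V \<Longrightarrow> y \<in> V \<Longrightarrow> z \<in> V \<Longrightarrow> m y (m x z) = m x (m y z)"
  using m_assoc[of y x z] m_assoc[of x y z] m_commute[of x y] by simp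

lemma C_closed: "x \<in> V \<Longrightarrow> y \<in> V \<Longrightarrow> z \<in> V \<Longrightarrow> C x y z \<in> V"
  by (simp add: C_def closed)

lemma C_sym_left: "x \<in> V \<Longrightarrow> y \<in> V \<Longrightarrow> z \<in> V \<Longrightarrow> C x y z = C y x z"
  unfolding C_def by (rule compatible)

lemma C_sym_right: "x \<in> V \<Longrightarrow> y \<in> V \<Longrightarrow> z \<in> V \<Longrightarrow> C x y z = C x z y"
  using m_commute by (simp add: C_def closed algebra_simps)

lemma D_m: "x \<in> V \<Longrightarrow> y \<in> V \<Longrightarrow> z \<in> V \<Longrightarrow> D x (m y z) = C x y z + m (D x y) z + m y (D x z)"
  by (simp add: C_def)

text \<open>
  Differentiate the associative law \<open>(x \<circ> y) \<circ> w = x \<circ> (y \<circ> w)\<close> in the direction \<open>z\<close>; the terms in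
  which an argument is differentiated cancel.
\<close>

lemma C_assoc:
  assumes "x \<in> V" "y \<in> V" "z \<in> V" "w \<in> V"
  shows "C z (m x y) w + m w (C z x y) = C z x (m y w) + m x (C z y w)"
proof -
  have "m (m x y) w = m x (m y w)" using assms by (simp add: m_assoc)
  then have "D z (m (m x y) w) = D z (m x (m y w))" by simp
  then have "C z (m x y) w + m (C z x y + m (D z x) y + m x (D z y)) w + m (m x y) (D z w) =
      C z x (m y w) + m (D z x) (m y w) + m x (C z y w + m (D z y) w + m y (D z w))"
    using assms by (simp add: D_m closed C_closed)
  moreover have "m (C z x y + m (D z x) y + m x (D z y)) w =
      m w (C z x y) + m (D z x) (m y w) + m x (m (D z y) w)"
    using assms by (simp add: m_add_left m_assoc closed C_closed m_commute[of "C z x y" w])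
  moreover have "m x (C z y w + m (D z y) w + m y (D z w)) =
      m x (C z y w) + m x (m (D z y) w) + m (m x y) (D z w)"
    using assms by (simp add: m_add m_assoc closed C_closed)
  ultimately show ?thesis by (simp add: algebra_simps)
qed

text \<open>
  Replace the brackets by covariant derivatives and collect the derivatives in direction \<open>x\<close>, which
  form \<open>(\<nabla>\<^sub>x c)(z, w)\<close>.
\<close>

lemma lie_product_eq:
  assumes "x \<in> V" "z \<in> V" "w \<in> V"
  shows "lie_product x z w = C x z w - D (m z w) x + m w (D z x) + m z (D w x)"
  using assms
  by (simp add: lie_product_def bracket_def D_m m_diff m_diff_left closed C_closed m_commute[of "D z x" w] algebra_simps)

text \<open>
  The terms of \<^term>\<open>lie_product\<close> without \<^term>\<open>C\<close> satisfy the identity after \<open>D u (m x y)\<close> is expanded. The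
  terms with \<^term>\<open>C\<close> agree by the sum of two differentiated associative laws, that of \<open>(x \<circ> y) \<circ> w\<close> in direction
  \<open>z\<close> and that of \<open>(y \<circ> w) \<circ> z\<close> in direction \<open>x\<close>, once \<^term>\<open>C\<close> is known to be totally symmetric.
\<close>

theorem Hertling_Manin:
  assumes V: "x \<in> V" "y \<in> V" "z \<in> V" "w \<in> V"
  shows "lie_product (m x y) z w = m x (lie_product y z w) + m y (lie_product x z w)"
proof -
  have 1: "C (m x y) z w + m w (C z x y) = C x z (m y w) + m x (C y z w)"
  proof -
    have "C z (m x y) w = C (m x y) z w" "C z x (m y w) = C x z (m y w)" "C z y w = C y z w"
      using V by (simp_all add: C_sym_left[of z] closed)
    then show ?thesis using C_assoc[OF V] by simp
  qed
  have 2: "C x z (m y w) + m z (C w x y) = C (m z w) x y + m y (C x z w)"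
  proof -
    have "C x (m y w) z = C x z (m y w)" "C x y w = C w x y" "C x w z = C x z w"
      using V C_sym_right[of x "m y w" z] C_sym_right[of x y w] C_sym_left[of x w y] C_sym_right[of x w z]
      by (simp_all add: closed)
    moreover have "C x y (m w z) = C (m z w) x y"
      using V C_sym_right[of x y "m w z"] C_sym_left[of x "m w z" y] m_commute[of w z] by (simp add: closed)
    ultimately show ?thesis
      using C_assoc[of y w x z] V by simp
  qed
  have "lie_product (m x y) z w = C (m x y) z w - (C (m z w) x y + m (D (m z w) x) y + m x (D (m z w) y))
      + m w (C z x y + m (D z x) y + m x (D z y)) + m z (C w x y + m (D w x) y + m x (D w y))"
    using V by (simp add: lie_product_eq D_m closed)
  also have "\<dots> = C (m x y) z w + m w (C z x y) + m z (C w x y) - C (m z w) x y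
      - m y (D (m z w) x) - m x (D (m z w) y) + m y (m w (D z x)) + m x (m w (D z y))
      + m y (m z (D w x)) + m x (m z (D w y))"
  proof -
    have "m (D u x) y = m y (D u x)" if "u \<in> V" for u
      using V that by (intro m_commute closed)
    then show ?thesis
      using V by (simp add: m_add closed C_closed m_left_commute[of y w] m_left_commute[of x w]
          m_left_commute[of y z] m_left_commute[of x z] algebra_simps)
  qed
  also have "C (m x y) z w + m w (C z x y) + m z (C w x y) - C (m z w) x y =
      m x (C y z w) + m y (C x z w)"
    using 1 2 by (simp add: algebra_simps)
  also have "m x (C y z w) + m y (C x z w)
      - m y (D (m z w) x) - m x (D (m z w) y) + m y (m w (D z x)) + m x (m w (D z y))
      + m y (m z (D w x)) + m x (m z (D w y)) = m x (lie_product y z w) + m y (lie_product x z w)"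
    using V by (simp add: lie_product_eq m_add m_diff closed C_closed algebra_simps)
  finally show ?thesis .
qed

text \<open>
  For \<open>D' x y = D x y + \<phi> (x \<circ> y)\<close> flatness and the symmetry of \<^term>\<open>C\<close> put the curvature into the form
  \<open>R x y v = \<beta> x (y \<circ> v) - \<beta> y (x \<circ> v)\<close>. For \<open>v = z \<circ> w\<close> the term \<open>\<beta> x (y \<circ> z \<circ> w)\<close> is symmetric in \<open>y\<close> and
  \<open>z\<close>, so the six terms of the cyclic sum cancel in pairs.
\<close>

theorem cyclic_curvature:
  fixes \<phi> :: "'v \<Rightarrow> 'v"
  defines "D' \<equiv> \<lambda>x y. D x y + \<phi> (m x y)"
  defines "R \<equiv> \<lambda>x y z. D' x (D' y z) - D' y (D' x z) - D' (bracket x y) z"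
  assumes \<phi>_closed: "\<And>x. x \<in> V \<Longrightarrow> \<phi> x \<in> V"
    and \<phi>_add: "\<And>x y. x \<in> V \<Longrightarrow> y \<in> V \<Longrightarrow> \<phi> (x + y) = \<phi> x + \<phi> y"
    and V: "x \<in> V" "y \<in> V" "z \<in> V" "w \<in> V"
  shows "R y z (m x w) + R x y (m z w) + R z x (m y w) = 0"
proof -
  have \<phi>_diff: "\<phi> (a - b) = \<phi> a - \<phi> b" if "a \<in> V" "b \<in> V" for a b
    using \<phi>_add[of "a - b" b] that by (simp add: closed)
  define \<beta> where "\<beta> a u = D a (\<phi> u) - \<phi> (D a u) + \<phi> (m a (\<phi> u))" for a u
  have R: "R a b v = \<beta> a (m b v) - \<beta> b (m a v)" if V: "a \<in> V" "b \<in> V" "v \<in> V" for a b v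
  proof -
    have expand: "D' a (D' b v) = D a (D b v) + D a (\<phi> (m b v)) + \<phi> (m a (D b v)) + \<phi> (m a (\<phi> (m b v)))"
      if "a \<in> V" "b \<in> V" for a b
      using that V by (simp add: D'_def D_add_right m_add \<phi>_add \<phi>_closed closed algebra_simps)
    have "m (bracket a b) v = D a (m b v) - D b (m a v) - m b (D a v) + m a (D b v)"
      using V compatible[of a b v] by (simp add: bracket_def m_diff_left closed algebra_simps)
    then have "\<phi> (m (bracket a b) v) = \<phi> (D a (m b v)) - \<phi> (D b (m a v)) - \<phi> (m b (D a v)) + \<phi> (m a (D b v))"
      using V by (simp add: \<phi>_add \<phi>_diff closed)
    moreover have "D (bracket a b) v = D a (D b v) - D b (D a v)"
      using flat[OF V] by (simp add: bracket_def)
    ultimately show ?thesis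
      using V unfolding R_def expand[OF V(1,2)] expand[OF V(2,1)]
      by (simp add: D'_def \<beta>_def algebra_simps)
  qed
  have "m z (m x w) = m x (m z w)" "m y (m x w) = m x (m y w)" "m y (m z w) = m z (m y w)"
    using V by (simp_all add: m_left_commute)
  then show ?thesis using V by (simp add: R closed)
qed

end

section \<open>Transfer of the algebra to vector fields\<close>

text \<open>
  Operations on local vector fields satisfy their laws only up to \<^const>\<open>eq_on_set\<close>. Setting vector
  fields to \<open>0\<close> off \<open>U\<close> selects one representative of each class, so that on representatives the laws
  become equations between functions.
\<close>

definition restrict_field :: "'a set \<Rightarrow> 'a vfield \<Rightarrow> 'a vfield" where
  "restrict_field U X = (\<lambda>p. if p \<in> U then X p else 0)"

lemma eq_on_set_iff: "eq_on_set U X Y \<longleftrightarrow> restrict_field U X = restrict_field U Y"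
  by (auto simp: eq_on_set_def restrict_field_def fun_eq_iff)

lemma restrict_field_add: "restrict_field U (X + Y) = restrict_field U X + restrict_field U Y"
  by (auto simp: restrict_field_def fun_eq_iff)

lemma restrict_field_uminus: "restrict_field U (- X) = - restrict_field U X"
  by (auto simp: restrict_field_def fun_eq_iff)

lemma restrict_field_diff: "restrict_field U (X - Y) = restrict_field U X - restrict_field U Y"
  by (auto simp: restrict_field_def fun_eq_iff)

lemma restrict_field_zero: "restrict_field U 0 = 0"
  by (auto simp: restrict_field_def fun_eq_iff)

lemma restrict_field_idem: "restrict_field U (restrict_field U X) = restrict_field U X"
  by (auto simp: restrict_field_def fun_eq_iff)

lemma eq_on_restrict: "eq_on_set U X (restrict_field U X)"
  by (simp add: eq_on_set_def restrict_field_def)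

context smooth_atlas
begin

lemma restrict_field_vfields: "X \<in> vfields M A U \<Longrightarrow> restrict_field U X \<in> vfields M A U"
  by (rule vfields_cong) (auto simp: restrict_field_def)

text \<open>
  By locality a biadditive operation may be applied to representatives.
\<close>

lemma restrict_biadditive:
  assumes "local_biadditive M A B" "openin M U" "X \<in> vfields M A U" "Y \<in> vfields M A U"
  shows "restrict_field U (B X Y) = restrict_field U (B (restrict_field U X) (restrict_field U Y))"
    and "restrict_field U (B (restrict_field U X) Y) = restrict_field U (B X Y)"
    and "restrict_field U (B X (restrict_field U Y)) = restrict_field U (B X Y)"
proof -
  note cong = local_biadditive_cong[OF assms, unfolded eq_on_set_iff]
  note r = restrict_field_vfields[OF assms(3)] restrict_field_vfields[OF assms(4)]
  show "restrict_field U (B X Y) = restrict_field U (B (restrict_field U X) (restrict_field U Y))"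
    by (rule cong) (simp_all only: r restrict_field_idem)
  show "restrict_field U (B (restrict_field U X) Y) = restrict_field U (B X Y)"
    by (rule cong[symmetric]) (simp_all only: r assms restrict_field_idem)
  show "restrict_field U (B X (restrict_field U Y)) = restrict_field U (B X Y)"
    by (rule cong[symmetric]) (simp_all only: r assms restrict_field_idem)
qed

lemma flat_F_manifoldD:
  assumes "flat_F_manifold M A m D e"
  shows "unital_product M A m e" "connection M A D" "torsionless M A D" "flat_connection M A D"
proof -
  note * = assms[unfolded flat_F_manifold_def]
  show "unital_product M A m e" by (rule conjunct1[OF *])
  show "connection M A D" by (rule conjunct1[OF conjunct2[OF *]])
  show "torsionless M A D" by (rule conjunct1[OF conjunct2[OF conjunct2[OF *]]])
  show "flat_connection M A D" by (rule conjunct1[OF conjunct2[OF conjunct2[OF conjunct2[OF *]]]])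
qed

lemma flat_F_manifold_at:
  assumes F: "flat_F_manifold M A m D e" and U: "openin M U"
    and X: "X \<in> vfields M A U"
  shows "eq_on_set U (D X e) 0"
    and "Y \<in> vfields M A U \<Longrightarrow> Z \<in> vfields M A U \<Longrightarrow>
      eq_on_set U (cov_deriv_product D m X Y Z) (cov_deriv_product D m Y X Z)"
    and "Y \<in> vfields M A U \<Longrightarrow> Z \<in> vfields M A U \<Longrightarrow> eq_on_set U (riemann M A D X Y Z) 0"
proof -
  note * = conjunct2[OF conjunct2[OF conjunct2[OF conjunct2[OF F[unfolded flat_F_manifold_def]]]]]
  show "eq_on_set U (D X e) 0"
    by (rule bspec[OF mp[OF spec[OF conjunct1[OF *]] U] X])
  note ** = bspec[OF bspec[OF bspec[OF mp[OF spec[OF conjunct2[OF *]] U] X]]]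
  show "eq_on_set U (cov_deriv_product D m X Y Z) (cov_deriv_product D m Y X Z)"
    if "Y \<in> vfields M A U" "Z \<in> vfields M A U"
    by (rule conjunct1[OF **[OF that]])
  show "eq_on_set U (riemann M A D X Y Z) 0" if "Y \<in> vfields M A U" "Z \<in> vfields M A U"
    by (rule bspec[OF bspec[OF bspec[OF mp[OF spec[OF
            flat_F_manifoldD(4)[OF F, unfolded flat_connection_def]] U] X] that(1)] that(2)])
qed

lemma lie_bracket_vfields:
  assumes "connection M A D" "torsionless M A D" "openin M U" "X \<in> vfields M A U" "Y \<in> vfields M A U"
  shows "lie_bracket M A X Y \<in> vfields M A U"
proof (rule vfields_cong)
  show "D X Y - D Y X \<in> vfields M A U"
    by (intro vfields_diff local_biadditive_vfields[OF connection_biadditive[OF assms(1)]] assms)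
qed (rule eq_on_setD[OF torsionlessD[OF assms(2-5)]])

lemma restricted_flat_F_algebra:
  assumes F: "flat_F_manifold M A m D e" and U: "openin M U"
  shows "flat_F_algebra {X \<in> vfields M A U. restrict_field U X = X}
    (\<lambda>X Y. restrict_field U (m X Y)) (\<lambda>X Y. restrict_field U (D X Y))"
proof -
  let ?r = "restrict_field U"
  note unital = flat_F_manifoldD(1)[OF F] and D = flat_F_manifoldD(2)[OF F] and torsion = flat_F_manifoldD(3)[OF F]
  note m_bi = smooth_bilinear_biadditive[OF unital_product_bilinear[OF unital]]
  note D_bi = connection_biadditive[OF D]
  note m_v = local_biadditive_vfields[OF m_bi U] and D_v = local_biadditive_vfields[OF D_bi U]
  note m_r = restrict_biadditive(2,3)[OF m_bi U] and D_r = restrict_biadditive(2,3)[OF D_bi U]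
  show ?thesis
  proof (unfold_locales, unfold mem_Collect_eq; (elim conjE)?)
    fix x y assume x: "x \<in> vfields M A U" and y: "y \<in> vfields M A U"
    show "?r (m x y) = ?r (m y x)"
      by (rule unital_product_commute[OF unital U x y, unfolded eq_on_set_iff])
    show "?r (m x y) \<in> vfields M A U \<and> ?r (?r (m x y)) = ?r (m x y)"
      by (intro conjI restrict_field_vfields restrict_field_idem m_v x y)
    show "?r (D x y) \<in> vfields M A U \<and> ?r (?r (D x y)) = ?r (D x y)"
      by (intro conjI restrict_field_vfields restrict_field_idem D_v x y)
    show "x + y \<in> vfields M A U \<and> ?r (x + y) = x + y" if "?r x = x" "?r y = y"
      by (intro conjI vfields_add x y) (simp only: restrict_field_add that)
    fix z assume z: "z \<in> vfields M A U"
    show "?r (m x (y + z)) = ?r (m x y) + ?r (m x z)"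
      by (rule local_biadditive_right[OF m_bi U y z x, unfolded eq_on_set_iff restrict_field_add])
    show "?r (D x (y + z)) = ?r (D x y) + ?r (D x z)"
      by (rule local_biadditive_right[OF D_bi U y z x, unfolded eq_on_set_iff restrict_field_add])
    show "?r (m (?r (m x y)) z) = ?r (m x (?r (m y z)))"
      using unital_product_assoc[OF unital U x y z]
      by (simp only: m_r[OF m_v[OF x y] z] m_r[OF x m_v[OF y z]] eq_on_set_iff)
    show "?r (D x (?r (m y z))) - ?r (m (?r (D x y)) z) - ?r (m y (?r (D x z))) =
        ?r (D y (?r (m x z))) - ?r (m (?r (D y x)) z) - ?r (m x (?r (D y z)))"
      using flat_F_manifold_at(2)[OF F U x y z]
      by (simp only: eq_on_set_iff cov_deriv_product_def restrict_field_diff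
          D_r(2)[OF x m_v[OF y z]] m_r(1)[OF D_v[OF x y] z] m_r(2)[OF y D_v[OF x z]]
          D_r(2)[OF y m_v[OF x z]] m_r(1)[OF D_v[OF y x] z] m_r(2)[OF x D_v[OF y z]])
    have "?r (D x y) - ?r (D y x) = ?r (lie_bracket M A x y)"
      using torsionlessD[OF torsion U x y] by (simp only: eq_on_set_iff restrict_field_diff)
    then show "?r (D x (?r (D y z))) - ?r (D y (?r (D x z))) - ?r (D (?r (D x y) - ?r (D y x)) z) = 0"
      using flat_F_manifold_at(3)[OF F U x y z]
      by (simp only: eq_on_set_iff riemann_def restrict_field_diff restrict_field_zero
          D_r(2)[OF x D_v[OF y z]] D_r(2)[OF y D_v[OF x z]]
          D_r(1)[OF lie_bracket_vfields[OF D torsion U x y] z])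
  next
    fix x assume x: "x \<in> vfields M A U" "?r x = x"
    show "- x \<in> vfields M A U \<and> ?r (- x) = - x"
      by (intro conjI vfields_uminus x) (simp only: restrict_field_uminus x)
  qed
qed

lemma flat_F_manifold_imp_F_manifold:
  assumes F: "flat_F_manifold M A m D e"
  shows "F_manifold M A m e"
  unfolding F_manifold_def
proof (intro conjI allI impI ballI)
  note unital = flat_F_manifoldD(1)[OF F] and D = flat_F_manifoldD(2)[OF F] and torsion = flat_F_manifoldD(3)[OF F]
  show "unital_product M A m e" by (rule unital)
  fix U X Y Z W assume U: "openin M U" and XY: "X \<in> vfields M A U" "Y \<in> vfields M A U"
    and ZW: "Z \<in> vfields M A U" "W \<in> vfields M A U"
  let ?r = "restrict_field U"
  let ?m = "\<lambda>X Y. ?r (m X Y)" and ?D = "\<lambda>X Y. ?r (D X Y)"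
  interpret flat_F_algebra "{X \<in> vfields M A U. ?r X = X}" ?m ?D
    by (rule restricted_flat_F_algebra[OF F U])
  note m_bi = smooth_bilinear_biadditive[OF unital_product_bilinear[OF unital]]
  note D_bi = connection_biadditive[OF D]
  note m_v = local_biadditive_vfields[OF m_bi U]
  note m_r = restrict_biadditive(1)[OF m_bi U] and D_r = restrict_biadditive(1)[OF D_bi U]
  note bracket_v = lie_bracket_vfields[OF D torsion U]
  have bracket: "?r (lie_bracket M A a b) = bracket (?r a) (?r b)"
    if "a \<in> vfields M A U" "b \<in> vfields M A U" for a b
    using torsionlessD[OF torsion U that]
    by (simp only: eq_on_set_iff restrict_field_diff bracket_def D_r[OF that] D_r[OF that(2,1)])
  have lie_product: "?r (lie_deriv_product M A a m b c) = lie_product (?r a) (?r b) (?r c)"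
    if a: "a \<in> vfields M A U" and b: "b \<in> vfields M A U" and c: "c \<in> vfields M A U" for a b c
    by (simp only: lie_deriv_product_def lie_product_def restrict_field_diff bracket[OF a m_v[OF b c]]
        m_r[OF bracket_v[OF a b] c] m_r[OF b bracket_v[OF a c]] bracket[OF a b] bracket[OF a c]
        m_r[OF b c])
  have lie_v: "lie_deriv_product M A a m b c \<in> vfields M A U"
    if "a \<in> vfields M A U" "b \<in> vfields M A U" "c \<in> vfields M A U" for a b c
    unfolding lie_deriv_product_def by (intro vfields_diff m_v bracket_v that)
  have r: "?r a \<in> {X \<in> vfields M A U. ?r X = X}" if "a \<in> vfields M A U" for a
    by (intro CollectI conjI restrict_field_vfields restrict_field_idem that)
  show "eq_on_set U (lie_deriv_product M A (m X Y) m Z W)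
      (m X (lie_deriv_product M A Y m Z W) + m Y (lie_deriv_product M A X m Z W))"
    using Hertling_Manin[OF r[OF XY(1)] r[OF XY(2)] r[OF ZW(1)] r[OF ZW(2)]]
    by (simp only: eq_on_set_iff restrict_field_add lie_product[OF m_v[OF XY] ZW] m_r[OF XY]
        m_r[OF XY(1) lie_v[OF XY(2) ZW]] m_r[OF XY(2) lie_v[OF XY(1) ZW]] lie_product[OF XY(1) ZW] lie_product[OF XY(2) ZW])
qed

end

section \<open>The Levi-Civita connection\<close>

context torsionless_connection
begin

text \<open>
  The correction turns \<open>D\<close> into the Levi-Civita connection of \<open>g\<close>.
\<close>

definition corrected :: "('a vfield \<Rightarrow> 'a vfield \<Rightarrow> 'a vfield) \<Rightarrow> 'a vfield \<Rightarrow> 'a vfield \<Rightarrow> 'a vfield" where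
  "corrected m X Y = D X Y + \<Phi> (m X Y)"

lemma connection_corrected:
  assumes m: "smooth_bilinear M A m"
  shows "connection M A (corrected m)"
proof -
  note m_bi = smooth_bilinear_biadditive[OF m] and D_bi = connection_biadditive[OF connection]
  show ?thesis
    unfolding connection_def local_biadditive_def
  proof (intro conjI allI impI ballI; (elim conjE)?)
    fix U X Y assume U: "openin M U" and X: "X \<in> vfields M A U" and Y: "Y \<in> vfields M A U"
    note m_v = local_biadditive_vfields[OF m_bi U]
    show "corrected m X Y \<in> vfields M A U"
      unfolding corrected_def by (intro vfields_add D_vfields[OF U] \<Phi>_vfields[OF U] m_v X Y)
    {
      fix h assume h: "smooth_fun A U h"
      note hX = vfields_fun_scale[OF X h] and hY = vfields_fun_scale[OF Y h]
      show "eq_on_set U (corrected m (fun_scale h X) Y) (fun_scale h (corrected m X Y))"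
      proof (rule eq_on_setI)
        fix p assume p: "p \<in> U"
        show "corrected m (fun_scale h X) Y p = fun_scale h (corrected m X Y) p"
          using eq_on_setD[OF connection_scale_left[OF connection U X Y h] p]
            eq_on_setD[OF \<Phi>_cong[OF U m_v[OF hX Y] vfields_fun_scale[OF m_v[OF X Y] h]
                smooth_bilinear_scale_left[OF m U X Y h]] p]
            eq_on_setD[OF \<Phi>_scale[OF U m_v[OF X Y] h] p]
          by (simp add: corrected_def fun_eq_iff fun_scale_def distrib_left)
      qed
      show "eq_on_set U (corrected m X (fun_scale h Y)) (fun_scale h (corrected m X Y) + fun_scale (vapply X h) Y)"
      proof (rule eq_on_setI)
        fix p assume p: "p \<in> U"
        show "corrected m X (fun_scale h Y) p = (fun_scale h (corrected m X Y) + fun_scale (vapply X h) Y) p"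
          using eq_on_setD[OF connection_Leibniz[OF connection U X Y h] p]
            eq_on_setD[OF \<Phi>_cong[OF U m_v[OF X hY] vfields_fun_scale[OF m_v[OF X Y] h]
                smooth_bilinear_scale_right[OF m U X Y h]] p]
            eq_on_setD[OF \<Phi>_scale[OF U m_v[OF X Y] h] p]
          by (simp add: corrected_def fun_eq_iff fun_scale_def distrib_left)
      qed
    }
    fix Z assume Z: "Z \<in> vfields M A U"
    show "eq_on_set U (corrected m (X + Y) Z) (corrected m X Z + corrected m Y Z)"
    proof (rule eq_on_setI)
      fix p assume p: "p \<in> U"
      show "corrected m (X + Y) Z p = (corrected m X Z + corrected m Y Z) p"
        using eq_on_setD[OF local_biadditive_left[OF D_bi U X Y Z] p]
          eq_on_setD[OF \<Phi>_cong[OF U m_v[OF vfields_add[OF X Y] Z] vfields_add[OF m_v[OF X Z] m_v[OF Y Z]]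
              local_biadditive_left[OF m_bi U X Y Z]] p]
          eq_on_setD[OF \<Phi>_add[OF U m_v[OF X Z] m_v[OF Y Z]] p]
        by (simp add: corrected_def ac_simps)
    qed
    show "eq_on_set U (corrected m Z (X + Y)) (corrected m Z X + corrected m Z Y)"
    proof (rule eq_on_setI)
      fix p assume p: "p \<in> U"
      show "corrected m Z (X + Y) p = (corrected m Z X + corrected m Z Y) p"
        using eq_on_setD[OF local_biadditive_right[OF D_bi U X Y Z] p]
          eq_on_setD[OF \<Phi>_cong[OF U m_v[OF Z vfields_add[OF X Y]] vfields_add[OF m_v[OF Z X] m_v[OF Z Y]]
              local_biadditive_right[OF m_bi U X Y Z]] p]
          eq_on_setD[OF \<Phi>_add[OF U m_v[OF Z X] m_v[OF Z Y]] p]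
        by (simp add: corrected_def ac_simps)
    qed
  next
    fix U X X' Y Y' assume U: "openin M U" and X: "X \<in> vfields M A U" "X' \<in> vfields M A U"
      and Y: "Y \<in> vfields M A U" "Y' \<in> vfields M A U" and eq: "eq_on_set U X X'" "eq_on_set U Y Y'"
    note m_v = local_biadditive_vfields[OF m_bi U]
    show "eq_on_set U (corrected m X Y) (corrected m X' Y')"
    proof (rule eq_on_setI)
      fix p assume p: "p \<in> U"
      show "corrected m X Y p = corrected m X' Y' p"
        using eq_on_setD[OF local_biadditive_cong[OF D_bi U X(1) Y(1) X(2) Y(2) eq] p]
          eq_on_setD[OF \<Phi>_cong[OF U m_v[OF X(1) Y(1)] m_v[OF X(2) Y(2)]
              local_biadditive_cong[OF m_bi U X(1) Y(1) X(2) Y(2) eq]] p]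
        by (simp add: corrected_def)
    qed
  qed
qed

text \<open>
  The correction is symmetric in \<open>X\<close> and \<open>Y\<close> since the product is commutative.
\<close>

lemma torsionless_corrected:
  assumes m: "smooth_bilinear M A m"
    and commute: "\<And>U X Y. openin M U \<Longrightarrow> X \<in> vfields M A U \<Longrightarrow> Y \<in> vfields M A U \<Longrightarrow>
      eq_on_set U (m X Y) (m Y X)"
  shows "torsionless M A (corrected m)"
  unfolding torsionless_def
proof (intro allI impI ballI eq_on_setI)
  fix U X Y p assume U: "openin M U" and X: "X \<in> vfields M A U" and Y: "Y \<in> vfields M A U" and p: "p \<in> U"
  note m_v = local_biadditive_vfields[OF smooth_bilinear_biadditive[OF m] U]
  have "\<Phi> (m X Y) p = \<Phi> (m Y X) p"
    by (rule eq_on_setD[OF \<Phi>_cong[OF U m_v[OF X Y] m_v[OF Y X] commute[OF U X Y]] p])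
  then show "(corrected m X Y - corrected m Y X) p = lie_bracket M A X Y p"
    using eq_on_setD[OF torsionlessD[OF torsionless U X Y] p] by (simp add: corrected_def)
qed

text \<open>
  By definition of \<open>\<Phi>\<close> the hypothesis on \<open>\<nabla>g\<close> reads
  \<open>(\<nabla>\<^sub>X g)(Y, Z) = g(\<Phi>(X \<circ> Y), Z) + g(Y, \<Phi>(X \<circ> Z))\<close>, which is what the correction subtracts.
\<close>

lemma levi_civita_corrected:
  assumes m: "smooth_bilinear M A m"
    and commute: "\<And>U X Y. openin M U \<Longrightarrow> X \<in> vfields M A U \<Longrightarrow> Y \<in> vfields M A U \<Longrightarrow>
      eq_on_set U (m X Y) (m Y X)"
    and nabla_g: "\<And>U X Y Z p. openin M U \<Longrightarrow> X \<in> vfields M A U \<Longrightarrow> Y \<in> vfields M A U \<Longrightarrow>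
      Z \<in> vfields M A U \<Longrightarrow> p \<in> U \<Longrightarrow>
      cov_deriv_metric D g X Y Z p = 1 / 2 * d\<theta> (m X Y) Z p + 1 / 2 * d\<theta> (m X Z) Y p"
  shows "levi_civita M A g (corrected m)"
  unfolding levi_civita_def
proof (intro conjI allI impI ballI eq_on_setI connection_corrected[OF m] torsionless_corrected[OF m commute])
  fix U X Y Z p assume U: "openin M U" and X: "X \<in> vfields M A U" and Y: "Y \<in> vfields M A U"
    and Z: "Z \<in> vfields M A U" and p: "p \<in> U"
  note m_v = local_biadditive_vfields[OF smooth_bilinear_biadditive[OF m] U]
  have pM: "p \<in> topspace M" using openin_subset[OF U] p by blast
  note T = vfields_tangent[OF _ p]
  note D_T = T[OF D_vfields[OF U]] and \<Phi>_T = T[OF \<Phi>_vfields[OF U]]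
  have "g p ((D X Y + \<Phi> (m X Y)) p) (Z p) = g p (D X Y p) (Z p) + g p (\<Phi> (m X Y) p) (Z p)"
    using metric_add_left[OF pM D_T[OF X Y] \<Phi>_T[OF m_v[OF X Y]] T[OF Z]] by simp
  moreover have "g p (Y p) ((D X Z + \<Phi> (m X Z)) p) = g p (Y p) (D X Z p) + g p (\<Phi> (m X Z) p) (Y p)"
    using metric_add_right[OF pM D_T[OF X Z] \<Phi>_T[OF m_v[OF X Z]] T[OF Y]]
      metric_sym[OF pM T[OF Y] \<Phi>_T[OF m_v[OF X Z]]] by simp
  ultimately have "cov_deriv_metric (corrected m) g X Y Z p = cov_deriv_metric D g X Y Z p
      - g p (\<Phi> (m X Y) p) (Z p) - g p (\<Phi> (m X Z) p) (Y p)"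
    by (simp add: cov_deriv_metric_def corrected_def mapply_def vapply_def del: plus_fun_apply)
  then show "cov_deriv_metric (corrected m) g X Y Z p = 0 p"
    using nabla_g[OF U X Y Z p] metric_\<Phi>[OF U p m_v[OF X Y] Z] metric_\<Phi>[OF U p m_v[OF X Z] Y] by simp
qed

lemma cyclic_curvature_corrected:
  assumes F: "flat_F_manifold M A m D e" and U: "openin M U"
    and V: "X \<in> vfields M A U" "Y \<in> vfields M A U" "Z \<in> vfields M A U" "W \<in> vfields M A U"
  shows "eq_on_set U (riemann M A (corrected m) Y Z (m X W) + riemann M A (corrected m) X Y (m Z W) +
    riemann M A (corrected m) Z X (m Y W)) 0"
proof -
  let ?r = "restrict_field U"
  let ?m = "\<lambda>X Y. ?r (m X Y)" and ?D = "\<lambda>X Y. ?r (D X Y)" and ?\<phi> = "\<lambda>X. ?r (\<Phi> X)"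
  interpret flat_F_algebra "{X \<in> vfields M A U. ?r X = X}" ?m ?D
    by (rule restricted_flat_F_algebra[OF F U])
  note bilin = unital_product_bilinear[OF flat_F_manifoldD(1)[OF F]]
  note m_bi = smooth_bilinear_biadditive[OF bilin]
  note n_bi = connection_biadditive[OF connection_corrected[OF bilin]]
  note m_v = local_biadditive_vfields[OF m_bi U] and n_v = local_biadditive_vfields[OF n_bi U]
  note m_r = restrict_biadditive(1)[OF m_bi U]
  note bracket_v = lie_bracket_vfields[OF connection torsionless U]
  have r: "?r a \<in> {X \<in> vfields M A U. ?r X = X}" if "a \<in> vfields M A U" for a
    by (intro CollectI conjI restrict_field_vfields restrict_field_idem that)
  define N where "N x y = ?D x y + ?\<phi> (?m x y)" for x y
  have \<Phi>_r: "?r (\<Phi> (?r a)) = ?r (\<Phi> a)" if "a \<in> vfields M A U" for a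
    using \<Phi>_cong[OF U that restrict_field_vfields[OF that] eq_on_restrict] by (simp only: eq_on_set_iff)
  have corrected: "?r (corrected m a b) = N (?r a) (?r b)" if "a \<in> vfields M A U" "b \<in> vfields M A U" for a b
    by (simp only: corrected_def N_def restrict_field_add \<Phi>_r[OF m_v[OF that]] m_r[OF that, symmetric]
        restrict_biadditive(1)[OF connection_biadditive[OF connection] U that, symmetric])
  have bracket: "?r (lie_bracket M A a b) = bracket (?r a) (?r b)"
    if "a \<in> vfields M A U" "b \<in> vfields M A U" for a b
    using torsionlessD[OF torsionless U that]
    by (simp only: eq_on_set_iff restrict_field_diff bracket_def
        restrict_biadditive(1)[OF connection_biadditive[OF connection] U that]
        restrict_biadditive(1)[OF connection_biadditive[OF connection] U that(2,1)])
  have riemann: "?r (riemann M A (corrected m) a b c) =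
      N (?r a) (N (?r b) (?r c)) - N (?r b) (N (?r a) (?r c)) - N (bracket (?r a) (?r b)) (?r c)"
    if a: "a \<in> vfields M A U" and b: "b \<in> vfields M A U" and c: "c \<in> vfields M A U" for a b c
    by (simp only: riemann_def restrict_field_diff corrected[OF a n_v[OF b c]] corrected[OF b n_v[OF a c]]
        corrected[OF b c] corrected[OF a c] corrected[OF bracket_v[OF a b] c] bracket[OF a b])
  have \<phi>_add: "?\<phi> (x + y) = ?\<phi> x + ?\<phi> y"
    if "x \<in> {X \<in> vfields M A U. ?r X = X}" "y \<in> {X \<in> vfields M A U. ?r X = X}" for x y
  proof (unfold restrict_field_add[symmetric] eq_on_set_iff[symmetric])
    show "eq_on_set U (\<Phi> (x + y)) (\<Phi> x + \<Phi> y)"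
      using that by (intro \<Phi>_add[OF U]) simp_all
  qed
  have "?\<phi> x \<in> {X \<in> vfields M A U. ?r X = X}" if "x \<in> {X \<in> vfields M A U. ?r X = X}" for x
    using that by (intro r \<Phi>_vfields[OF U]) simp
  from cyclic_curvature[of ?\<phi>, OF this \<phi>_add r[OF V(1)] r[OF V(2)] r[OF V(3)] r[OF V(4)], folded N_def]
  show ?thesis
    by (simp only: eq_on_set_iff restrict_field_add restrict_field_zero
        riemann[OF V(2) V(3) m_v[OF V(1) V(4)]] riemann[OF V(1) V(2) m_v[OF V(3) V(4)]]
        riemann[OF V(3) V(1) m_v[OF V(2) V(4)]] m_r[OF V(1) V(4)] m_r[OF V(3) V(4)] m_r[OF V(2) V(4)])
qed

text \<open>
  Since \<open>\<nabla>\<xi> = 0\<close> and \<open>D\<close> is torsionless, \<open>[\<xi>, Z] = \<nabla>\<^sub>\<xi> Z\<close>, so the Lie derivative of \<open>g\<close> along \<open>\<xi>\<close> is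
  \<open>\<nabla>\<^sub>\<xi> g\<close>. As \<open>\<xi>\<close> is the unit, the latter is the symmetrisation of \<open>d\<theta> / 2\<close> and vanishes.
\<close>

lemma Killing_unit:
  assumes unital: "unital_product M A m \<xi>"
    and parallel: "\<And>X. X \<in> vfields M A U \<Longrightarrow> eq_on_set U (D X \<xi>) 0"
    and nabla_g: "\<And>Y Z p. Y \<in> vfields M A U \<Longrightarrow> Z \<in> vfields M A U \<Longrightarrow> p \<in> U \<Longrightarrow>
      cov_deriv_metric D g \<xi> Y Z p = 1 / 2 * d\<theta> (m \<xi> Y) Z p + 1 / 2 * d\<theta> (m \<xi> Z) Y p"
    and U: "openin M U" and X: "X \<in> vfields M A U" and Y: "Y \<in> vfields M A U"
  shows "eq_on_set U (lie_deriv_metric M A \<xi> g X Y) 0"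
proof (rule eq_on_setI)
  fix p assume p: "p \<in> U"
  note \<xi> = \<xi>_on[OF U]
  note m_v = local_biadditive_vfields[OF smooth_bilinear_biadditive[OF unital_product_bilinear[OF unital]] U \<xi>]
  have bracket: "lie_bracket M A \<xi> Z p = D \<xi> Z p" if "Z \<in> vfields M A U" for Z
    using eq_on_setD[OF torsionlessD[OF torsionless U \<xi> that] p] eq_on_setD[OF parallel[OF that] p] by simp
  have unit: "d\<theta> (m \<xi> Z) W p = d\<theta> Z W p" if "Z \<in> vfields M A U" "W \<in> vfields M A U" for Z W
    by (rule ext_deriv_cong[OF U p m_v[OF that(1)] that(2) that])
       (simp_all add: unital_product_unit_left[OF unital U that(1) that(1)] eq_on_set_def[of U W W])
  have "lie_deriv_metric M A \<xi> g X Y p = cov_deriv_metric D g \<xi> X Y p"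
    by (simp add: lie_deriv_metric_def cov_deriv_metric_def mapply_def bracket[OF X] bracket[OF Y])
  also have "\<dots> = 1 / 2 * d\<theta> X Y p + 1 / 2 * d\<theta> Y X p"
    by (simp only: nabla_g[OF X Y p] unit[OF X Y] unit[OF Y X])
  also have "\<dots> = 0" using ext_deriv_skew[OF U p X Y] by simp
  finally show "lie_deriv_metric M A \<xi> g X Y p = 0 p" by simp
qed

end

section \<open>The Riemannian F-manifold of a flat F-manifold\<close>

theorem theorem1p13:
  fixes M :: "'a topology"
    and A :: "('a, 'e::euclidean_space) chart set"
    and m :: "'a vfield \<Rightarrow> 'a vfield \<Rightarrow> 'a vfield"
    and D :: "'a vfield \<Rightarrow> 'a vfield \<Rightarrow> 'a vfield"
    and e :: "'a vfield"
    and g :: "'a metric_field"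
    and \<theta> :: "'a vfield \<Rightarrow> 'a \<Rightarrow> real"
  assumes "smooth_manifold M A"
    and "flat_F_manifold M A m D e"
    and "pseudo_riemannian_metric M A g"
    and "invariant_metric M A m g"
    and "\<And>X. \<theta> X = mapply g e X"
    and "\<And>U X Y Z p. openin M U \<Longrightarrow> X \<in> vfields M A U \<Longrightarrow> Y \<in> vfields M A U \<Longrightarrow>
           Z \<in> vfields M A U \<Longrightarrow> p \<in> U \<Longrightarrow>
           cov_deriv_metric D g X Y Z p =
             1 / 2 * ext_deriv M A \<theta> (m X Y) Z p + 1 / 2 * ext_deriv M A \<theta> (m X Z) Y p"
  shows "riemannian_F_manifold_Killing_unit M A m g e"
proof -
  interpret smooth_atlas M A by unfold_locales (rule assms(1))
  note F = assms(2)
  note unital = flat_F_manifoldD(1)[OF F]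
  note bilinear = unital_product_bilinear[OF unital]
  interpret torsionless_connection M A g D e
    by unfold_locales
       (rule assms(3) flat_F_manifoldD[OF F] unital_product_unit[OF unital])+
  have "\<theta> = mapply g e" by (rule ext) (rule assms(5))
  note nabla_g = assms(6)[unfolded this]
  show ?thesis
    unfolding riemannian_F_manifold_Killing_unit_def
  proof (intro conjI exI[of _ "corrected m"] allI impI ballI)
    show "F_manifold M A m e" by (rule flat_F_manifold_imp_F_manifold[OF F])
    show "levi_civita M A g (corrected m)"
      by (rule levi_civita_corrected[OF bilinear unital_product_commute[OF unital] nabla_g])
    fix U assume U: "openin M U"
    show "eq_on_set U (lie_deriv_metric M A e g X Y) 0"
      if "X \<in> vfields M A U" "Y \<in> vfields M A U" for X Y
      by (rule Killing_unit[OF unital flat_F_manifold_at(1)[OF F U] nabla_g[OF U \<xi>_on[OF U]] U that])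
  qed (rule assms(3,4) cyclic_curvature_corrected[OF F]; assumption?)+
qed

end
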